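(* Let $(M^{2n+1},\phi,\xi,\eta,g)$ be an almost $\alpha$-paracosymplectic manifold. Then, for all vector fields $X,Y$ on $M$, $$R(X,Y)\xi=d\alpha(X)(Y-\eta(Y)\xi)-d\alpha(Y)(X-\eta(X)\xi)+\alpha\,\eta(X)(\alpha Y+\phi hY)-\alpha\,\eta(Y)(\alpha X+\phi hX)+(\nabla_X\phi h)Y-(\nabla_Y\phi h)X .$$
   Context: An almost paracontact metric manifold is a smooth manifold $M$ of dimension $2n+1$ with a $(1,1)$-tensor field $\phi$, a vector field $\xi$, a 1-form $\eta$ and a pseudo-Riemannian metric $g$ of signature $(n+1,n)$ such that $\eta(\xi)=1$, $\phi^2=\mathrm{Id}-\eta\otimes\xi$, the eigendistributions of $\phi|_{\ker\eta}$ for the eigenvalues $+1$ and $-1$ both have rank $n$, and $g(\phi X,\phi Y)=-g(X,Y)+\eta(X)\eta(Y)$ (hence $\eta(X)=g(X,\xi)$, $\phi\xi=0$, $\eta\circ\phi=0$). Its fundamental 2-form is $\Phi(X,Y)=g(\phi X,Y)$. It is almost $\alpha$-paracosymplectic, where $\alpha$ is a smooth real function on $M$ (possibly constant), if $d\eta=0$ and $d\Phi=2\alpha\,\eta\wedge\Phi$ (with $d$ and $\wedge$ normalized compatibly, so that the cyclic sum of $(\nabla_X\Phi)(Y,Z)$ equals $2\alpha$ times the cyclic sum of $\eta(X)\Phi(Y,Z)$). $\nabla$ is the Levi-Civita connection of $g$, $R(X,Y)Z=\nabla_X\nabla_YZ-\nabla_Y\nabla_XZ-\nabla_{[X,Y]}Z$,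 $h=\frac12\mathcal{L}_\xi\phi$ (Lie derivative), and $\nabla_X\phi h$ denotes the covariant derivative of the composition $\phi\circ h$. *)

theory Defs
  imports "HOL-Analysis.Analysis" "HOL-Library.Function_Algebras"
begin

section \<open>Smooth manifolds\<close>

text \<open>
  The order-\<open>k\<close> condition is meant for open \<open>S\<close>, where \<^term>\<open>frechet_derivative f (at x) v\<close>
  is the directional derivative of \<open>f\<close> at \<open>x\<close> in the direction \<open>v\<close>.
\<close>

primrec Ck_on ::
  "nat \<Rightarrow> 'e::euclidean_space set \<Rightarrow> ('e \<Rightarrow> 'f::euclidean_space) \<Rightarrow> bool" where
  "Ck_on 0 S f \<longleftrightarrow> continuous_on S f"
| "Ck_on (Suc k) S f \<longleftrightarrow>
     f differentiable_on S \<and> (\<forall>v. Ck_on k S (\<lambda>x. frechet_derivative f (at x) v))"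

definition smooth_on ::
  "'e::euclidean_space set \<Rightarrow> ('e \<Rightarrow> 'f::euclidean_space) \<Rightarrow> bool" where
  "smooth_on S f \<longleftrightarrow> (\<forall>k. Ck_on k S f)"

text \<open>
  The points of the manifold are the elements of a Hausdorff, second countable type \<open>'a\<close>.
  A chart is a pair of a domain and a coordinate map into the model space \<open>'e\<close>; the coordinate map
  is only relevant on the domain. The atlas need not be maximal.
\<close>

type_synonym ('a, 'e) atlas = "('a set \<times> ('a \<Rightarrow> 'e)) set"

locale smooth_manifold =
  fixes \<A> :: "('a::{t2_space, second_countable_topology}, 'e::euclidean_space) atlas"
  assumes charts_cover: "(\<Union>(U, c)\<in>\<A>. U) = UNIV"
    and chart_open: "(U, c) \<in> \<A> \<Longrightarrow> open U \<and> open (c ` U)"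
    and chart_homeomorphism: "(U, c) \<in> \<A> \<Longrightarrow> homeomorphism U (c ` U) c (inv_into U c)"
    and charts_compatible:
      "(U, c) \<in> \<A> \<Longrightarrow> (V, d) \<in> \<A> \<Longrightarrow> smooth_on (c ` (U \<inter> V)) (d \<circ> inv_into U c)"

definition smooth_fun ::
  "('a::topological_space, 'e::euclidean_space) atlas \<Rightarrow> ('a \<Rightarrow> real) set" where
  "smooth_fun \<A> = {f. \<forall>(U, c)\<in>\<A>. smooth_on (c ` U) (f \<circ> inv_into U c)}"


section \<open>Tangent vectors and vector fields\<close>

text \<open>
  Tangent vectors at \<open>p\<close> are the derivations at \<open>p\<close> of the algebra of smooth functions. As
  functions in HOL are total, a tangent vector is required to vanish on functions that are not
  smooth, so that equality of tangent vectors is equality of derivations.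
\<close>

type_synonym 'a tvec = "('a \<Rightarrow> real) \<Rightarrow> real"

definition tangent_space ::
  "('a::topological_space, 'e::euclidean_space) atlas \<Rightarrow> 'a \<Rightarrow> 'a tvec set" where
  "tangent_space \<A> p = {v.
     (\<forall>f\<in>smooth_fun \<A>. \<forall>g\<in>smooth_fun \<A>. v (f + g) = v f + v g) \<and>
     (\<forall>r. \<forall>f\<in>smooth_fun \<A>. v (\<lambda>q. r * f q) = r * v f) \<and>
     (\<forall>f\<in>smooth_fun \<A>. \<forall>g\<in>smooth_fun \<A>. v (f * g) = f p * v g + g p * v f) \<and>
     (\<forall>f. f \<notin> smooth_fun \<A> \<longrightarrow> v f = 0)}"

definition tscale :: "real \<Rightarrow> 'a tvec \<Rightarrow> 'a tvec" where
  "tscale r v = (\<lambda>f. r * v f)"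

interpretation tvec: vector_space tscale
  by standard (simp_all add: tscale_def fun_eq_iff algebra_simps)

type_synonym 'a vfield = "'a \<Rightarrow> 'a tvec"

definition vector_fields ::
  "('a::topological_space, 'e::euclidean_space) atlas \<Rightarrow> 'a vfield set" where
  "vector_fields \<A> = {X. (\<forall>p. X p \<in> tangent_space \<A> p) \<and>
     (\<forall>f\<in>smooth_fun \<A>. (\<lambda>p. X p f) \<in> smooth_fun \<A>)}"

definition fscale :: "('a \<Rightarrow> real) \<Rightarrow> 'a vfield \<Rightarrow> 'a vfield"  (infixr "\<odot>" 75) where
  "f \<odot> X = (\<lambda>p. tscale (f p) (X p))"

definition deriv_along :: "'a vfield \<Rightarrow> ('a \<Rightarrow> real) \<Rightarrow> 'a \<Rightarrow> real" where
  "deriv_along X f = (\<lambda>p. X p f)"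

definition lie_bracket :: "'a vfield \<Rightarrow> 'a vfield \<Rightarrow> 'a vfield" where
  "lie_bracket X Y = (\<lambda>p f. X p (deriv_along Y f) - Y p (deriv_along X f))"


section \<open>Tensor fields\<close>

text \<open>
  Tensor fields are families of multilinear maps on the tangent spaces; smoothness means that
  smooth vector fields are taken to smooth functions or smooth vector fields. Values at arguments
  that are not tangent vectors are irrelevant.
\<close>

type_synonym 'a form1 = "'a \<Rightarrow> 'a tvec \<Rightarrow> real"
type_synonym 'a form2 = "'a \<Rightarrow> 'a tvec \<Rightarrow> 'a tvec \<Rightarrow> real"
type_synonym 'a endo = "'a \<Rightarrow> 'a tvec \<Rightarrow> 'a tvec"

definition ev :: "('a \<Rightarrow> 'a tvec \<Rightarrow> 'b) \<Rightarrow> 'a vfield \<Rightarrow> 'a \<Rightarrow> 'b"  ("_\<langle>_\<rangle>" [1000, 0] 1000) where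
  "T\<langle>X\<rangle> = (\<lambda>p. T p (X p))"

definition ev2 :: "'a form2 \<Rightarrow> 'a vfield \<Rightarrow> 'a vfield \<Rightarrow> 'a \<Rightarrow> real"
    ("_\<langle>_,/ _\<rangle>" [1000, 0, 0] 1000) where
  "B\<langle>X, Y\<rangle> = (\<lambda>p. B p (X p) (Y p))"

definition one_form ::
  "('a::topological_space, 'e::euclidean_space) atlas \<Rightarrow> 'a form1 \<Rightarrow> bool" where
  "one_form \<A> \<omega> \<longleftrightarrow>
     (\<forall>p. \<forall>u\<in>tangent_space \<A> p. \<forall>v\<in>tangent_space \<A> p. \<omega> p (u + v) = \<omega> p u + \<omega> p v) \<and>
     (\<forall>p r. \<forall>u\<in>tangent_space \<A> p. \<omega> p (tscale r u) = r * \<omega> p u) \<and>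
     (\<forall>X\<in>vector_fields \<A>. \<omega>\<langle>X\<rangle> \<in> smooth_fun \<A>)"

definition endomorphism_field ::
  "('a::topological_space, 'e::euclidean_space) atlas \<Rightarrow> 'a endo \<Rightarrow> bool" where
  "endomorphism_field \<A> T \<longleftrightarrow>
     (\<forall>p. \<forall>u\<in>tangent_space \<A> p. T p u \<in> tangent_space \<A> p) \<and>
     (\<forall>p. \<forall>u\<in>tangent_space \<A> p. \<forall>v\<in>tangent_space \<A> p. T p (u + v) = T p u + T p v) \<and>
     (\<forall>p r. \<forall>u\<in>tangent_space \<A> p. T p (tscale r u) = tscale r (T p u)) \<and>
     (\<forall>X\<in>vector_fields \<A>. T\<langle>X\<rangle> \<in> vector_fields \<A>)"

definition symmetric_2_tensor ::
  "('a::topological_space, 'e::euclidean_space) atlas \<Rightarrow> 'a form2 \<Rightarrow> bool" where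
  "symmetric_2_tensor \<A> g \<longleftrightarrow>
     (\<forall>p. \<forall>u\<in>tangent_space \<A> p. \<forall>v\<in>tangent_space \<A> p. g p u v = g p v u) \<and>
     (\<forall>p. \<forall>u\<in>tangent_space \<A> p. \<forall>v\<in>tangent_space \<A> p. \<forall>w\<in>tangent_space \<A> p.
        g p (u + v) w = g p u w + g p v w) \<and>
     (\<forall>p r. \<forall>u\<in>tangent_space \<A> p. \<forall>v\<in>tangent_space \<A> p. g p (tscale r u) v = r * g p u v) \<and>
     (\<forall>X\<in>vector_fields \<A>. \<forall>Y\<in>vector_fields \<A>. g\<langle>X, Y\<rangle> \<in> smooth_fun \<A>)"

definition nondegenerate ::
  "('a::topological_space, 'e::euclidean_space) atlas \<Rightarrow> 'a form2 \<Rightarrow> bool" where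
  "nondegenerate \<A> g \<longleftrightarrow>
     (\<forall>p. \<forall>u\<in>tangent_space \<A> p. (\<forall>v\<in>tangent_space \<A> p. g p u v = 0) \<longrightarrow> u = 0)"

definition has_signature ::
  "('a::topological_space, 'e::euclidean_space) atlas \<Rightarrow> 'a form2 \<Rightarrow> nat \<Rightarrow> nat \<Rightarrow> bool" where
  "has_signature \<A> g r s \<longleftrightarrow>
     (\<forall>p. \<exists>e :: nat \<Rightarrow> 'a tvec.
        inj_on e {..<r + s} \<and> tvec.independent (e ` {..<r + s}) \<and>
        tvec.span (e ` {..<r + s}) = tangent_space \<A> p \<and>
        (\<forall>i<r + s. \<forall>j<r + s.
           g p (e i) (e j) = (if i \<noteq> j then 0 else if i < r then 1 else - 1)))"

definition pseudo_riemannian_metric ::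
  "('a::topological_space, 'e::euclidean_space) atlas \<Rightarrow> nat \<Rightarrow> nat \<Rightarrow> 'a form2 \<Rightarrow> bool" where
  "pseudo_riemannian_metric \<A> r s g \<longleftrightarrow>
     symmetric_2_tensor \<A> g \<and> nondegenerate \<A> g \<and> has_signature \<A> g r s"

definition differential :: "('a \<Rightarrow> real) \<Rightarrow> 'a form1" where
  "differential f = (\<lambda>p v. v f)"

text \<open>
  Exterior derivatives are given by the invariant formula without numerical factors; the wedge
  product below is normalized accordingly.
\<close>

definition ext_deriv1 :: "'a form1 \<Rightarrow> 'a vfield \<Rightarrow> 'a vfield \<Rightarrow> 'a \<Rightarrow> real" where
  "ext_deriv1 \<omega> X Y =
     deriv_along X (\<omega>\<langle>Y\<rangle>) - deriv_along Y (\<omega>\<langle>X\<rangle>) - \<omega>\<langle>lie_bracket X Y\<rangle>"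

definition ext_deriv2 ::
  "'a form2 \<Rightarrow> 'a vfield \<Rightarrow> 'a vfield \<Rightarrow> 'a vfield \<Rightarrow> 'a \<Rightarrow> real" where
  "ext_deriv2 \<Omega> X Y Z =
     deriv_along X (\<Omega>\<langle>Y, Z\<rangle>) + deriv_along Y (\<Omega>\<langle>Z, X\<rangle>) + deriv_along Z (\<Omega>\<langle>X, Y\<rangle>)
     - \<Omega>\<langle>lie_bracket X Y, Z\<rangle> - \<Omega>\<langle>lie_bracket Y Z, X\<rangle> - \<Omega>\<langle>lie_bracket Z X, Y\<rangle>"

definition wedge12 ::
  "'a form1 \<Rightarrow> 'a form2 \<Rightarrow> 'a vfield \<Rightarrow> 'a vfield \<Rightarrow> 'a vfield \<Rightarrow> 'a \<Rightarrow> real" where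
  "wedge12 \<omega> \<Omega> X Y Z = \<omega>\<langle>X\<rangle> * \<Omega>\<langle>Y, Z\<rangle> + \<omega>\<langle>Y\<rangle> * \<Omega>\<langle>Z, X\<rangle> + \<omega>\<langle>Z\<rangle> * \<Omega>\<langle>X, Y\<rangle>"


section \<open>Connections and curvature\<close>

type_synonym 'a connection = "'a vfield \<Rightarrow> 'a vfield \<Rightarrow> 'a vfield"

definition affine_connection ::
  "('a::topological_space, 'e::euclidean_space) atlas \<Rightarrow> 'a connection \<Rightarrow> bool" where
  "affine_connection \<A> nabla \<longleftrightarrow>
     (\<forall>X\<in>vector_fields \<A>. \<forall>Y\<in>vector_fields \<A>. nabla X Y \<in> vector_fields \<A>) \<and>
     (\<forall>X\<in>vector_fields \<A>. \<forall>Y\<in>vector_fields \<A>. \<forall>Z\<in>vector_fields \<A>.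
        nabla (X + Y) Z = nabla X Z + nabla Y Z) \<and>
     (\<forall>f\<in>smooth_fun \<A>. \<forall>X\<in>vector_fields \<A>. \<forall>Y\<in>vector_fields \<A>.
        nabla (f \<odot> X) Y = f \<odot> nabla X Y) \<and>
     (\<forall>X\<in>vector_fields \<A>. \<forall>Y\<in>vector_fields \<A>. \<forall>Z\<in>vector_fields \<A>.
        nabla X (Y + Z) = nabla X Y + nabla X Z) \<and>
     (\<forall>f\<in>smooth_fun \<A>. \<forall>X\<in>vector_fields \<A>. \<forall>Y\<in>vector_fields \<A>.
        nabla X (f \<odot> Y) = deriv_along X f \<odot> Y + f \<odot> nabla X Y)"

definition levi_civita ::
  "('a::topological_space, 'e::euclidean_space) atlas \<Rightarrow> 'a form2 \<Rightarrow> 'a connection \<Rightarrow> bool" where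
  "levi_civita \<A> g nabla \<longleftrightarrow>
     affine_connection \<A> nabla \<and>
     (\<forall>X\<in>vector_fields \<A>. \<forall>Y\<in>vector_fields \<A>. nabla X Y - nabla Y X = lie_bracket X Y) \<and>
     (\<forall>X\<in>vector_fields \<A>. \<forall>Y\<in>vector_fields \<A>. \<forall>Z\<in>vector_fields \<A>.
        deriv_along X (g\<langle>Y, Z\<rangle>) = g\<langle>nabla X Y, Z\<rangle> + g\<langle>Y, nabla X Z\<rangle>)"

definition curvature ::
  "'a connection \<Rightarrow> 'a vfield \<Rightarrow> 'a vfield \<Rightarrow> 'a vfield \<Rightarrow> 'a vfield" where
  "curvature nabla X Y Z =
     nabla X (nabla Y Z) - nabla Y (nabla X Z) - nabla (lie_bracket X Y) Z"

text \<open>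
  Covariant and Lie derivatives of endomorphism fields, viewed as operators on vector fields.
\<close>

definition cov_deriv_endo ::
  "'a connection \<Rightarrow> 'a vfield \<Rightarrow> ('a vfield \<Rightarrow> 'a vfield) \<Rightarrow> 'a vfield \<Rightarrow> 'a vfield" where
  "cov_deriv_endo nabla X T Y = nabla X (T Y) - T (nabla X Y)"

definition lie_deriv_endo ::
  "'a vfield \<Rightarrow> ('a vfield \<Rightarrow> 'a vfield) \<Rightarrow> 'a vfield \<Rightarrow> 'a vfield" where
  "lie_deriv_endo V T X = lie_bracket V (T X) - T (lie_bracket V X)"


section \<open>Almost \<open>\<alpha>\<close>-paracosymplectic manifolds\<close>

locale almost_paracontact_metric_manifold = smooth_manifold \<A>
  for \<A> :: "('a::{t2_space, second_countable_topology}, 'e::euclidean_space) atlas" +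
  fixes n :: nat
    and \<phi> :: "'a endo" and \<xi> :: "'a vfield" and \<eta> :: "'a form1" and g :: "'a form2"
  assumes dimension: "DIM('e) = 2 * n + 1"
    and phi: "endomorphism_field \<A> \<phi>"
    and xi: "\<xi> \<in> vector_fields \<A>"
    and eta: "one_form \<A> \<eta>"
    and metric: "pseudo_riemannian_metric \<A> (n + 1) n g"
    and eta_xi: "\<eta> p (\<xi> p) = 1"
    and phi_phi: "v \<in> tangent_space \<A> p \<Longrightarrow> \<phi> p (\<phi> p v) = v - tscale (\<eta> p v) (\<xi> p)"
    and rank_plus: "tvec.dim {v \<in> tangent_space \<A> p. \<eta> p v = 0 \<and> \<phi> p v = v} = n"
    and rank_minus: "tvec.dim {v \<in> tangent_space \<A> p. \<eta> p v = 0 \<and> \<phi> p v = - v} = n"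
    and metric_phi: "u \<in> tangent_space \<A> p \<Longrightarrow> v \<in> tangent_space \<A> p \<Longrightarrow>
      g p (\<phi> p u) (\<phi> p v) = - g p u v + \<eta> p u * \<eta> p v"

definition fundamental_form :: "'a endo \<Rightarrow> 'a form2 \<Rightarrow> 'a form2" where
  "fundamental_form \<phi> g = (\<lambda>p u v. g p (\<phi> p u) v)"

definition h_operator :: "'a endo \<Rightarrow> 'a vfield \<Rightarrow> 'a vfield \<Rightarrow> 'a vfield" where
  "h_operator \<phi> \<xi> X = (\<lambda>p. 1 / 2) \<odot> lie_deriv_endo \<xi> (ev \<phi>) X"

locale almost_alpha_paracosymplectic_manifold = almost_paracontact_metric_manifold \<A> n \<phi> \<xi> \<eta> g
  for \<A> :: "('a::{t2_space, second_countable_topology}, 'e::euclidean_space) atlas"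
    and n :: nat
    and \<phi> :: "'a endo" and \<xi> :: "'a vfield" and \<eta> :: "'a form1" and g :: "'a form2" +
  fixes \<alpha> :: "'a \<Rightarrow> real"
  assumes alpha: "\<alpha> \<in> smooth_fun \<A>"
    and eta_closed: "X \<in> vector_fields \<A> \<Longrightarrow> Y \<in> vector_fields \<A> \<Longrightarrow> ext_deriv1 \<eta> X Y = 0"
    and d_fundamental_form:
      "X \<in> vector_fields \<A> \<Longrightarrow> Y \<in> vector_fields \<A> \<Longrightarrow> Z \<in> vector_fields \<A> \<Longrightarrow>
       ext_deriv2 (fundamental_form \<phi> g) X Y Z
         = 2 * \<alpha> * wedge12 \<eta> (fundamental_form \<phi> g) X Y Z"

end

theory Submission
  imports Defs
begin

text \<open>
  The curvature \<open>R(X, Y)\<xi>\<close> is the antisymmetrized second covariant derivative of \<open>\<xi>\<close>, so everything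
  rests on the first derivative, \<open>\<nabla>\<^sub>Y \<xi> = \<alpha> \<phi>\<^sup>2 Y + \<phi> h Y\<close> (lemma \<open>nabla_xi_eq\<close>). Once this is known,
  differentiating it and using that \<open>\<eta>\<close> is closed gives the claim by algebra
  (theorem \<open>curvature_xi\<close>).

  Put \<open>A = \<nabla>\<xi>\<close> and \<open>B = \<nabla>\<^sub>\<xi> \<phi>\<close>. Closedness of \<open>\<eta>\<close> says that \<open>A\<close> is self-adjoint, and \<open>g(\<xi>, \<xi>) = 1\<close>
  gives \<open>\<eta> \<circ> A = 0\<close>, hence \<open>A \<xi> = 0\<close>. Evaluating \<open>d\<Phi> = 2\<alpha> \<eta> \<and> \<Phi>\<close> with \<open>\<xi>\<close> in one slot gives
  \<open>B + \<phi>A + A\<phi> = 2\<alpha>\<phi>\<close> (lemma \<open>cov_deriv_xi_phi\<close>). This relation forces \<open>B\<close> to commute with \<open>\<phi>\<close>, while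
  differentiating \<open>\<phi>\<^sup>2 = Id - \<eta> \<otimes> \<xi>\<close> makes it anticommute; therefore \<open>\<phi>B = 0\<close> and
  \<open>A + \<phi>A\<phi> = 2\<alpha>\<phi>\<^sup>2\<close>. By torsion-freeness \<open>2h = B - A\<phi> + \<phi>A\<close>, so \<open>2\<phi>h = A - \<phi>A\<phi>\<close>. The sum of the
  last two equations is the formula for \<open>A\<close>.

  These equations between vector fields come from equations between their scalar products with
  arbitrary vector fields. To cancel the metric, which is nondegenerate on each space of derivations,
  one needs the values of vector fields to span each tangent space
  (lemma \<open>tangent_space_subset_span_vector_fields\<close>). Multiplying the coordinate fields of a chart
  by a smooth bump function yields \<open>2n + 1\<close> vector fields that are independent at a given point, and
  the signature of the metric says that the tangent space has dimension \<open>2n + 1\<close>.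
\<close>

section \<open>Closure properties of \<open>C\<^sup>k\<close> functions on open sets\<close>

lemma Ck_on_cong:
  assumes "open S" "\<And>x. x \<in> S \<Longrightarrow> f x = g x" "Ck_on k S f"
  shows "Ck_on k S g"
  using assms(2,3)
proof (induction k arbitrary: f g)
  case 0
  then show ?case by (simp cong: continuous_on_cong)
next
  case (Suc k)
  have der: "(g has_derivative frechet_derivative f (at x)) (at x)" if "x \<in> S" for x
  proof -
    have "(f has_derivative frechet_derivative f (at x)) (at x)"
      using Suc.prems(2) that \<open>open S\<close>
      by (auto simp: differentiable_on_eq_differentiable_at frechet_derivative_works[symmetric])
    then show ?thesis
      using has_derivative_transform_within_open[OF _ \<open>open S\<close> that] Suc.prems(1) by blast
  qed
  then have "g differentiable_on S"
    using \<open>open S\<close> by (auto simp: differentiable_on_eq_differentiable_at differentiable_def)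
  moreover have "Ck_on k S (\<lambda>x. frechet_derivative g (at x) v)" for v
  proof (rule Suc.IH)
    show "Ck_on k S (\<lambda>x. frechet_derivative f (at x) v)" using Suc.prems by simp
  qed (use frechet_derivative_at[OF der] in metis)
  ultimately show ?case by simp
qed

text \<open>
  The derivative is unique on an open set, so any explicitly known derivative may stand for the
  abstract one. The inductions below on the order differentiate once by a standard rule and recognize
  the resulting directional derivatives as instances of lower order.
\<close>

lemma Ck_on_SucI:
  assumes "open S" "\<And>x. x \<in> S \<Longrightarrow> (f has_derivative D x) (at x)" "\<And>v. Ck_on k S (\<lambda>x. D x v)"
  shows "Ck_on (Suc k) S f"
proof -
  have "f differentiable_on S"
    using assms by (auto simp: differentiable_on_eq_differentiable_at differentiable_def)
  moreover have "Ck_on k S (\<lambda>x. frechet_derivative f (at x) v)" for v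
    by (rule Ck_on_cong[OF assms(1) _ assms(3)[of v]]) (use frechet_derivative_at[OF assms(2)] in metis)
  ultimately show ?thesis by simp
qed

lemma Ck_on_Suc_has_derivative:
  assumes "open S" "Ck_on (Suc k) S f" "x \<in> S"
  shows "(f has_derivative frechet_derivative f (at x)) (at x)"
  using assms by (auto simp: differentiable_on_eq_differentiable_at frechet_derivative_works[symmetric])

lemma Ck_on_Suc_imp: "Ck_on (Suc k) S f \<Longrightarrow> Ck_on k S f"
proof (induction k arbitrary: f)
  case 0
  then show ?case by (simp add: differentiable_imp_continuous_on)
next
  case (Suc k)
  then show ?case using Ck_on.simps(2) by blast
qed

lemma Ck_on_Union:
  assumes "\<And>T. T \<in> \<C> \<Longrightarrow> open T \<and> Ck_on k T f"
  shows "Ck_on k (\<Union>\<C>) f"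
  using assms
proof (induction k arbitrary: f)
  case 0
  then show ?case by (auto intro!: continuous_on_open_Union)
next
  case (Suc k)
  then have "f differentiable at x" if "x \<in> \<Union>\<C>" for x
    using that by (metis Ck_on.simps(2) Union_iff differentiable_on_eq_differentiable_at)
  moreover have "Ck_on k (\<Union>\<C>) (\<lambda>x. frechet_derivative f (at x) v)" for v
    by (rule Suc.IH) (use Suc.prems in auto)
  ultimately show ?case
    by (auto simp: differentiable_on_def differentiable_at_withinI)
qed

lemma Ck_on_const: "Ck_on k S (\<lambda>x. c)"
  by (induction k arbitrary: c) auto

lemma Ck_on_bounded_linear_comp:
  assumes "open S" "bounded_linear L" "Ck_on k S f"
  shows "Ck_on k S (\<lambda>x. L (f x))"
  using assms(3)
proof (induction k arbitrary: f)
  case 0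
  then show ?case
    using bounded_linear.continuous_on[OF assms(2)] by simp
next
  case (Suc k)
  show ?case
  proof (rule Ck_on_SucI[OF \<open>open S\<close>])
    show "((\<lambda>x. L (f x)) has_derivative (\<lambda>v. L (frechet_derivative f (at x) v))) (at x)"
      if "x \<in> S" for x
      using bounded_linear.has_derivative[OF assms(2) Ck_on_Suc_has_derivative[OF \<open>open S\<close> Suc.prems that]] .
    show "Ck_on k S (\<lambda>x. L (frechet_derivative f (at x) v))" for v
      using Suc by auto
  qed
qed

lemma Ck_on_bounded_linear:
  assumes "open S" "bounded_linear L"
  shows "Ck_on k S L"
proof (cases k)
  case 0
  then show ?thesis using assms linear_continuous_on by auto
next
  case (Suc l)
  show ?thesis unfolding Suc
    by (rule Ck_on_SucI[OF assms(1), where D="\<lambda>x. L"])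
      (use assms in \<open>auto intro: Ck_on_const bounded_linear_imp_has_derivative\<close>)
qed

lemma Ck_on_add:
  assumes "open S" "Ck_on k S f" "Ck_on k S g"
  shows "Ck_on k S (\<lambda>x. f x + g x)"
  using assms(2,3)
proof (induction k arbitrary: f g)
  case 0
  then show ?case by (auto intro: continuous_intros)
next
  case (Suc k)
  show ?case
  proof (rule Ck_on_SucI[OF \<open>open S\<close>])
    show "((\<lambda>x. f x + g x) has_derivative
      (\<lambda>v. frechet_derivative f (at x) v + frechet_derivative g (at x) v)) (at x)" if "x \<in> S" for x
      using Ck_on_Suc_has_derivative[OF \<open>open S\<close> _ that] Suc.prems by (blast intro: has_derivative_add)
    show "Ck_on k S (\<lambda>x. frechet_derivative f (at x) v + frechet_derivative g (at x) v)" for v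
      using Suc by auto
  qed
qed

lemma Ck_on_sum:
  assumes "open S" "\<And>i. i \<in> I \<Longrightarrow> Ck_on k S (f i)"
  shows "Ck_on k S (\<lambda>x. \<Sum>i\<in>I. f i x)"
  using assms(2)
  by (induction I rule: infinite_finite_induct) (auto intro: Ck_on_const Ck_on_add[OF assms(1)])

lemma Ck_on_scaleR:
  assumes "open S" "Ck_on k S f" "Ck_on k S g"
  shows "Ck_on k S (\<lambda>x. f x *\<^sub>R g x)"
  using assms(2,3)
proof (induction k arbitrary: f g)
  case 0
  then show ?case by (auto intro: continuous_intros)
next
  case (Suc k)
  show ?case
  proof (rule Ck_on_SucI[OF \<open>open S\<close>])
    show "((\<lambda>x. f x *\<^sub>R g x) has_derivative
      (\<lambda>v. f x *\<^sub>R frechet_derivative g (at x) v + frechet_derivative f (at x) v *\<^sub>R g x)) (at x)"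
      if "x \<in> S" for x
      using Suc.prems
      by (intro has_derivative_scaleR Ck_on_Suc_has_derivative[OF \<open>open S\<close> _ that])
    show "Ck_on k S (\<lambda>x. f x *\<^sub>R frechet_derivative g (at x) v + frechet_derivative f (at x) v *\<^sub>R g x)" for v
      using Suc.prems Suc.prems[THEN Ck_on_Suc_imp]
      by (intro Ck_on_add[OF \<open>open S\<close>] Suc.IH) simp_all
  qed
qed

text \<open>
  The chain rule expresses the directional derivative of the composition through the partial
  derivatives of the outer function, \<open>D(g \<circ> f)(x) v = \<Sum>\<^sub>b \<langle>Df(x) v, b\<rangle> D\<^sub>b g(f x)\<close>, which is a finite sum of
  products of functions of order \<open>k\<close>.
\<close>

lemma Ck_on_compose:
  assumes "open S" "open T" "Ck_on k S f" "Ck_on k T g" "f ` S \<subseteq> T"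
  shows "Ck_on k S (\<lambda>x. g (f x))"
  using assms(3-)
proof (induction k arbitrary: g)
  case 0
  then show ?case using continuous_on_compose2 by auto
next
  case (Suc k)
  show ?case
  proof (rule Ck_on_SucI[OF \<open>open S\<close>])
    show "((\<lambda>x. g (f x)) has_derivative
      (\<lambda>v. \<Sum>b\<in>Basis. (frechet_derivative f (at x) v \<bullet> b) *\<^sub>R frechet_derivative g (at (f x)) b)) (at x)"
      if "x \<in> S" for x
    proof -
      have f: "(f has_derivative frechet_derivative f (at x)) (at x)"
        and g: "(g has_derivative frechet_derivative g (at (f x))) (at (f x))"
        using Ck_on_Suc_has_derivative Suc.prems assms that by blast+
      have "frechet_derivative g (at (f x)) w = (\<Sum>b\<in>Basis. (w \<bullet> b) *\<^sub>R frechet_derivative g (at (f x)) b)" for w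
        using linear_sum[OF has_derivative_linear[OF g], of "\<lambda>b. (w \<bullet> b) *\<^sub>R b" Basis]
        by (simp add: euclidean_representation linear_cmul[OF has_derivative_linear[OF g]])
      then show ?thesis
        by (intro has_derivative_eq_rhs[OF has_derivative_compose[OF f g]] ext)
    qed
    show "Ck_on k S (\<lambda>x. \<Sum>b\<in>Basis. (frechet_derivative f (at x) v \<bullet> b) *\<^sub>R frechet_derivative g (at (f x)) b)" for v
    proof (intro Ck_on_sum[OF \<open>open S\<close>] Ck_on_scaleR[OF \<open>open S\<close>])
      fix b :: 'b
      show "Ck_on k S (\<lambda>x. frechet_derivative f (at x) v \<bullet> b)"
        using Suc.prems(1) by (intro Ck_on_bounded_linear_comp[OF \<open>open S\<close> bounded_linear_inner_left]) auto
      show "Ck_on k S (\<lambda>x. frechet_derivative g (at (f x)) b)"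
        by (rule Suc.IH[where g="\<lambda>y. frechet_derivative g (at y) b"])
          (use Suc.prems Suc.prems(1)[THEN Ck_on_Suc_imp] in simp_all)
    qed
  qed
qed

section \<open>Smooth bump functions\<close>

text \<open>
  The function \<open>exp (-1/t)\<close>, extended by zero to \<open>t \<le> 0\<close>, is the case \<open>m = 0\<close>. The other members of
  the family are there because the family is, up to linear combinations, closed under
  differentiation.
\<close>

definition flat :: "nat \<Rightarrow> real \<Rightarrow> real" where
  "flat m t = (if t \<le> 0 then 0 else inverse t ^ m * exp (- inverse t))"

text \<open>
  With \<open>s = 1/t\<close> this is the fact that \<open>exp s\<close> outgrows every power of \<open>s\<close>. It gives continuity at the
  origin, and, because \<open>flat m t / t = flat (m + 1) t\<close>, differentiability there as well.
\<close>

lemma flat_tendsto_0: "(flat m \<longlongrightarrow> 0) (at 0)"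
proof -
  have "((\<lambda>t. inverse t ^ m / exp (inverse t)) \<longlongrightarrow> 0) (at_right (0::real))"
    by (rule filterlim_compose[OF tendsto_power_div_exp_0 filterlim_inverse_at_top_right])
  then have "(flat m \<longlongrightarrow> 0) (at_right 0)"
    by (rule tendsto_cong[THEN iffD1, rotated])
      (auto simp: flat_def eventually_at_filter exp_minus field_simps)
  moreover have "(flat m \<longlongrightarrow> 0) (at_left 0)"
    by (rule tendsto_eventually) (auto simp: flat_def eventually_at_filter)
  ultimately show ?thesis by (simp add: filterlim_at_split)
qed

lemma flat_has_derivative:
  "(flat m has_real_derivative flat (m + 2) t - m * flat (m + 1) t) (at t)"
proof -
  consider "t < 0" | "t = 0" | "t > 0" by linarith
  then show ?thesis
  proof cases
    case 1
    have "((\<lambda>t. 0) has_real_derivative 0) (at t)" by simp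
    then have "(flat m has_real_derivative 0) (at t)"
      by (rule DERIV_cong_ev[THEN iffD1, rotated 3])
        (use 1 eventually_nhds_in_open[of "{..<0}" t] in \<open>auto simp: flat_def elim!: eventually_mono\<close>)
    with 1 show ?thesis by (simp add: flat_def)
  next
    case 2
    have "((\<lambda>y. (flat m y - flat m 0) / (y - 0)) \<longlongrightarrow> 0) (at 0)"
      by (rule tendsto_cong[THEN iffD1, OF _ flat_tendsto_0[of "Suc m"]])
        (auto simp: flat_def eventually_at_filter field_simps)
    with 2 show ?thesis by (simp add: has_field_derivative_iff flat_def)
  next
    case 3
    have "((\<lambda>t. inverse t ^ m * exp (- inverse t)) has_real_derivative
        inverse t ^ m * (exp (- inverse t) * (inverse t)^2)
        - m * inverse t ^ (m - 1) * (inverse t)^2 * exp (- inverse t)) (at t)"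
      using 3 by (auto intro!: derivative_eq_intros simp: power2_eq_square)
    also have "inverse t ^ m * (exp (- inverse t) * (inverse t)^2)
        - m * inverse t ^ (m - 1) * (inverse t)^2 * exp (- inverse t)
      = flat (m + 2) t - m * flat (m + 1) t"
      using 3 by (cases m) (simp_all add: flat_def power_add power2_eq_square)
    finally have "((\<lambda>t. inverse t ^ m * exp (- inverse t)) has_real_derivative
        flat (m + 2) t - m * flat (m + 1) t) (at t)" .
    then show ?thesis
      by (rule DERIV_cong_ev[THEN iffD1, rotated 3])
        (use 3 eventually_nhds_in_open[of "{0<..}" t] in \<open>auto simp: flat_def elim!: eventually_mono\<close>)
  qed
qed

lemma Ck_on_flat: "Ck_on k UNIV (flat m)"
proof (induction k arbitrary: m)
  case 0
  show ?case
    using flat_has_derivative by (auto intro!: DERIV_continuous_on simp: has_field_derivative_at_within)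
next
  case (Suc k)
  show ?case
  proof (rule Ck_on_SucI)
    show "(flat m has_derivative (\<lambda>v. v *\<^sub>R (flat (m + 2) t + (- real m) *\<^sub>R flat (m + 1) t))) (at t)" for t
      using flat_has_derivative[of m t] by (simp add: has_field_derivative_def mult.commute[of _ "_ - _"])
    show "Ck_on k UNIV (\<lambda>t. v *\<^sub>R (flat (m + 2) t + (- real m) *\<^sub>R flat (m + 1) t))" for v
      by (intro Ck_on_scaleR Ck_on_add Ck_on_const Suc.IH open_UNIV)
  qed simp
qed

text \<open>
  For \<open>r > 0\<close> positive on the open ball of radius \<open>r\<close> around \<open>a\<close> and zero outside, without a plateau at \<open>a\<close>. The
  squared distance is used because, unlike the distance, it is smooth at \<open>a\<close>.
\<close>

definition bump :: "'e::euclidean_space \<Rightarrow> real \<Rightarrow> 'e \<Rightarrow> real" where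
  "bump a r x = flat 0 (r^2 - (x - a) \<bullet> (x - a))"

lemma Ck_on_bump: "Ck_on k UNIV (bump a r)"
proof -
  have quadratic: "Ck_on k UNIV (\<lambda>x. r^2 - (x - a) \<bullet> (x - a))"
  proof (cases k)
    case 0
    then show ?thesis by (simp add: continuous_intros)
  next
    case (Suc l)
    show ?thesis unfolding Suc
    proof (rule Ck_on_SucI)
      show "((\<lambda>x. r^2 - (x - a) \<bullet> (x - a)) has_derivative
          (\<lambda>v. x \<bullet> (- 2 *\<^sub>R v) + 2 * (a \<bullet> v))) (at x)" for x
      proof -
        have "((\<lambda>x. r^2 - (x - a) \<bullet> (x - a)) has_derivative
            (\<lambda>v. 0 - ((x - a) \<bullet> (v - 0) + (v - 0) \<bullet> (x - a)))) (at x)"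
          by (intro has_derivative_diff has_derivative_const has_derivative_inner has_derivative_ident)
        then show ?thesis
          by (simp add: inner_diff_left inner_diff_right inner_commute algebra_simps)
      qed
      show "Ck_on l UNIV (\<lambda>x. x \<bullet> (- 2 *\<^sub>R v) + 2 * (a \<bullet> v))" for v
        by (intro Ck_on_add Ck_on_const Ck_on_bounded_linear bounded_linear_inner_left open_UNIV)
    qed simp
  qed
  have "Ck_on k UNIV (\<lambda>x. flat 0 (r^2 - (x - a) \<bullet> (x - a)))"
    by (rule Ck_on_compose[OF open_UNIV open_UNIV quadratic Ck_on_flat subset_UNIV])
  moreover have "bump a r = (\<lambda>x. flat 0 (r^2 - (x - a) \<bullet> (x - a)))"
    by (simp add: bump_def fun_eq_iff)
  ultimately show ?thesis by simp
qed

lemma bump_center_pos: "0 < r \<Longrightarrow> 0 < bump a r a"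
  by (simp add: bump_def flat_def)

lemma bump_outside_eq_0:
  assumes "0 < r" "x \<notin> cball a r"
  shows "bump a r x = 0"
proof -
  have "r < norm (x - a)" using assms(2) by (simp add: dist_norm norm_minus_commute)
  then have "r^2 \<le> (norm (x - a))^2" using assms(1) by (intro power_mono) auto
  then show ?thesis by (simp add: bump_def flat_def power2_norm_eq_inner)
qed

section \<open>Global vector fields span every tangent space\<close>

context smooth_manifold
begin

lemma smooth_fun_iff:
  "f \<in> smooth_fun \<A> \<longleftrightarrow> (\<forall>U c k. (U, c) \<in> \<A> \<longrightarrow> Ck_on k (c ` U) (\<lambda>x. f (inv_into U c x)))"
  by (auto simp: smooth_fun_def smooth_on_def o_def)

lemma smooth_fun_Ck_on:
  "f \<in> smooth_fun \<A> \<Longrightarrow> (U, c) \<in> \<A> \<Longrightarrow> Ck_on k (c ` U) (\<lambda>x. f (inv_into U c x))"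
  by (simp add: smooth_fun_iff)

lemma smooth_fun_has_derivative:
  assumes "f \<in> smooth_fun \<A>" "(U, c) \<in> \<A>" "q \<in> U"
  shows "((\<lambda>x. f (inv_into U c x)) has_derivative
    frechet_derivative (\<lambda>x. f (inv_into U c x)) (at (c q))) (at (c q))"
  using Ck_on_Suc_has_derivative[OF _ smooth_fun_Ck_on[OF assms(1,2)]] chart_open[OF assms(2)] assms(3)
  by blast

lemma smooth_fun_const: "(\<lambda>p. r) \<in> smooth_fun \<A>"
  by (simp add: smooth_fun_iff Ck_on_const)

lemma smooth_fun_add: "f \<in> smooth_fun \<A> \<Longrightarrow> g \<in> smooth_fun \<A> \<Longrightarrow> f + g \<in> smooth_fun \<A>"
  using chart_open by (auto simp: smooth_fun_iff intro!: Ck_on_add)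

lemma smooth_fun_mult: "f \<in> smooth_fun \<A> \<Longrightarrow> g \<in> smooth_fun \<A> \<Longrightarrow> f * g \<in> smooth_fun \<A>"
  using chart_open by (auto simp: smooth_fun_iff intro!: Ck_on_scaleR[where 'b = real, simplified])

lemma smooth_fun_scale: "f \<in> smooth_fun \<A> \<Longrightarrow> (\<lambda>p. r * f p) \<in> smooth_fun \<A>"
  using smooth_fun_mult[OF smooth_fun_const[of r]] by (simp add: times_fun_def)

lemma chart_inverse:
  assumes "(U, c) \<in> \<A>" "q \<in> U"
  shows "inv_into U c (c q) = q"
  using homeomorphism_apply1[OF chart_homeomorphism[OF assms(1)] assms(2)] .

lemma chart_image_open:
  assumes "(U, c) \<in> \<A>" "open W" "W \<subseteq> U"
  shows "open (c ` W)"
proof -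
  have "openin (top_of_set U) W"
    using assms chart_open openin_open_eq by blast
  then have "openin (top_of_set (c ` U)) (c ` W)"
    by (rule homeomorphism_imp_open_map[OF chart_homeomorphism[OF assms(1)]])
  then show ?thesis using chart_open[OF assms(1)] openin_open_eq by blast
qed

text \<open>
  The extension by zero is smooth because every chart domain \<open>V\<close> is the union of the open sets
  \<open>V \<inter> U\<close>, where the function is a composition with a transition map, and \<open>V - K\<close>, where it
  vanishes. Here \<open>K\<close> is the compact preimage of the ball in the chart, which is closed since the
  manifold is Hausdorff.
\<close>

lemma smooth_fun_bump_extension:
  assumes chart: "(U, c) \<in> \<A>" and r: "0 < r" and ball: "cball a r \<subseteq> c ` U"
    and u: "\<And>k. Ck_on k (c ` U) u"
  shows "(\<lambda>q. if q \<in> U then bump a r (c q) * u (c q) else 0) \<in> smooth_fun \<A>"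
  unfolding smooth_fun_iff
proof (intro allI impI)
  fix V d k
  assume chart': "(V, d) \<in> \<A>"
  define F where "F = (\<lambda>q. if q \<in> U then bump a r (c q) * u (c q) else 0)"
  define K where "K = inv_into U c ` cball a r"
  have "continuous_on (cball a r) (inv_into U c)"
    using homeomorphism_cont2[OF chart_homeomorphism[OF chart]] ball continuous_on_subset by blast
  then have "closed K"
    unfolding K_def by (intro compact_imp_closed compact_continuous_image compact_cball)
  then have open2: "open (d ` (V - K))"
    using chart' chart_open by (intro chart_image_open[OF chart']) auto
  have open1: "open (d ` (V \<inter> U))"
    using chart chart' chart_open by (intro chart_image_open[OF chart']) auto
  have K_cover: "q \<in> K" if "q \<in> U" "c q \<in> cball a r" for q
    using that chart_inverse[OF chart that(1)] unfolding K_def by (metis imageI)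
  have "Ck_on k (d ` (V \<inter> U)) (\<lambda>y. F (inv_into V d y))"
  proof (rule Ck_on_cong[OF open1])
    let ?t = "\<lambda>y. c (inv_into V d y)"
    have t: "Ck_on k (d ` (V \<inter> U)) ?t"
      using charts_compatible[OF chart' chart] by (simp add: smooth_on_def o_def)
    show "Ck_on k (d ` (V \<inter> U)) (\<lambda>y. bump a r (?t y) *\<^sub>R u (?t y))"
    proof (rule Ck_on_scaleR[OF open1])
      show "Ck_on k (d ` (V \<inter> U)) (\<lambda>y. bump a r (?t y))"
        by (rule Ck_on_compose[OF open1 open_UNIV t Ck_on_bump]) simp
      show "Ck_on k (d ` (V \<inter> U)) (\<lambda>y. u (?t y))"
        using chart_inverse[OF chart'] chart_open[OF chart]
        by (intro Ck_on_compose[OF open1 _ t u]) auto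
    qed
  qed (auto simp: F_def chart_inverse[OF chart'])
  moreover have "Ck_on k (d ` (V - K)) (\<lambda>y. F (inv_into V d y))"
    by (rule Ck_on_cong[OF open2 _ Ck_on_const[where c = 0]])
      (use K_cover bump_outside_eq_0[OF r] in \<open>force simp: F_def chart_inverse[OF chart']\<close>)
  ultimately have "Ck_on k (\<Union>{d ` (V \<inter> U), d ` (V - K)}) (\<lambda>y. F (inv_into V d y))"
    using open1 open2 by (intro Ck_on_Union) auto
  moreover have "K \<subseteq> U"
    using ball chart_inverse[OF chart] unfolding K_def by auto
  then have "V \<inter> U \<union> (V - K) = V" by blast
  then have "\<Union>{d ` (V \<inter> U), d ` (V - K)} = d ` V"
    by (simp add: image_Un[symmetric])
  ultimately show "Ck_on k (d ` V) (\<lambda>x. (if inv_into V d x \<in> U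
      then bump a r (c (inv_into V d x)) * u (c (inv_into V d x)) else 0))"
    by (simp add: F_def)
qed

text \<open>
  The coordinate field of a chart in the direction \<open>b\<close>, cut off by a bump function so that it becomes
  a field on the whole manifold. The value on functions that are not smooth is zero, as required of
  tangent vectors.
\<close>

definition bump_coord_field :: "'a set \<Rightarrow> ('a \<Rightarrow> 'e) \<Rightarrow> 'e \<Rightarrow> real \<Rightarrow> 'e \<Rightarrow> 'a vfield" where
  "bump_coord_field U c a r b = (\<lambda>q f. if q \<in> U \<and> f \<in> smooth_fun \<A>
     then bump a r (c q) * frechet_derivative (\<lambda>x. f (inv_into U c x)) (at (c q)) b else 0)"

lemma bump_coord_field_in_vector_fields:
  assumes chart: "(U, c) \<in> \<A>" and r: "0 < r" and ball: "cball a r \<subseteq> c ` U"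
  shows "bump_coord_field U c a r b \<in> vector_fields \<A>"
proof -
  have "bump_coord_field U c a r b q \<in> tangent_space \<A> q" for q
  proof -
    let ?D = "\<lambda>f. frechet_derivative (\<lambda>x. f (inv_into U c x)) (at (c q))"
    have add: "?D (f + g) b = ?D f b + ?D g b"
      and mult: "?D (f * g) b = f q * ?D g b + g q * ?D f b"
      if f: "f \<in> smooth_fun \<A>" and g: "g \<in> smooth_fun \<A>" and q: "q \<in> U" for f g
    proof -
      note df = smooth_fun_has_derivative[OF f chart q] and dg = smooth_fun_has_derivative[OF g chart q]
      show "?D (f + g) b = ?D f b + ?D g b"
        using frechet_derivative_at[OF has_derivative_add[OF df dg], symmetric] by simp
      show "?D (f * g) b = f q * ?D g b + g q * ?D f b"
        using frechet_derivative_at[OF has_derivative_mult[OF df dg], symmetric]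
        by (simp add: chart_inverse[OF chart q])
    qed
    have scale: "?D (\<lambda>p. s * f p) b = s * ?D f b" if "f \<in> smooth_fun \<A>" "q \<in> U" for f s
      using mult[OF smooth_fun_const[of s] that] frechet_derivative_const
      by (simp add: times_fun_def)
    show ?thesis
      unfolding tangent_space_def bump_coord_field_def
      by (auto simp: add[simplified] mult[simplified] scale smooth_fun_add smooth_fun_mult
          smooth_fun_scale algebra_simps)
  qed
  moreover have "(\<lambda>q. bump_coord_field U c a r b q f) \<in> smooth_fun \<A>" if f: "f \<in> smooth_fun \<A>" for f
  proof -
    have "Ck_on k (c ` U) (\<lambda>y. frechet_derivative (\<lambda>x. f (inv_into U c x)) (at y) b)" for k
      using smooth_fun_Ck_on[OF f chart, of "Suc k"] by simp
    from smooth_fun_bump_extension[OF chart r ball this] show ?thesis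
      by (simp add: bump_coord_field_def f)
  qed
  ultimately show ?thesis by (simp add: vector_fields_def)
qed

text \<open>
  The cut-off coordinate functions are globally smooth test functions that are dual, up to a positive
  factor, to the cut-off coordinate fields. The derivative of the bump function itself does not
  contribute, because it is multiplied by a coordinate centered at the point.
\<close>

lemma bump_coord_field_apply_coordinate:
  fixes b b' :: 'e
  assumes chart: "(U, c) \<in> \<A>" and r: "0 < r" and ball: "cball a r \<subseteq> c ` U"
    and p: "p \<in> U" "c p = a" and basis: "b \<in> Basis" "b' \<in> Basis"
  shows "bump_coord_field U c a r b p (\<lambda>q. if q \<in> U then bump a r (c q) * ((c q - a) \<bullet> b') else 0)
    = (if b = b' then (bump a r a)\<^sup>2 else 0)"
proof -
  let ?f = "\<lambda>q. if q \<in> U then bump a r (c q) * ((c q - a) \<bullet> b') else 0"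
  have "Ck_on k (c ` U) (\<lambda>x. (x - a) \<bullet> b')" for k
  proof -
    have "Ck_on k (c ` U) (\<lambda>x. x \<bullet> b' + - (a \<bullet> b'))"
      using chart_open[OF chart]
      by (intro Ck_on_add Ck_on_bounded_linear Ck_on_const bounded_linear_inner_left) auto
    then show ?thesis by (simp add: inner_diff_left)
  qed
  from smooth_fun_bump_extension[OF chart r ball this] have f: "?f \<in> smooth_fun \<A>" .
  have "(bump a r has_derivative frechet_derivative (bump a r) (at a)) (at a)"
    using Ck_on_Suc_has_derivative[OF open_UNIV Ck_on_bump] by blast
  then have "((\<lambda>x. bump a r x * ((x - a) \<bullet> b')) has_derivative
      (\<lambda>v. bump a r a * ((v - 0) \<bullet> b') + frechet_derivative (bump a r) (at a) v * ((a - a) \<bullet> b'))) (at a)"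
    by (intro has_derivative_mult has_derivative_inner_left has_derivative_diff
        has_derivative_ident has_derivative_const)
  then have "((\<lambda>x. bump a r x * ((x - a) \<bullet> b')) has_derivative (\<lambda>v. bump a r a * (v \<bullet> b'))) (at a)"
    by simp
  then have "((\<lambda>x. ?f (inv_into U c x)) has_derivative (\<lambda>v. bump a r a * (v \<bullet> b'))) (at a)"
    by (rule has_derivative_transform_within_open[where s = "c ` U"])
      (use chart_open[OF chart] p in \<open>auto simp: chart_inverse[OF chart]\<close>)
  from frechet_derivative_at[OF this, symmetric] show ?thesis
    using f p basis unfolding bump_coord_field_def
    by (simp add: power2_eq_square inner_Basis)
qed

text \<open>
  The cut-off coordinate fields at \<open>p\<close> are \<open>DIM('e)\<close> independent tangent vectors, so they span as soon
  as the tangent space is known to be spanned by some \<open>DIM('e)\<close> vectors \<open>E\<close>: a further independent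
  vector would contradict the exchange lemma. For a metric, \<open>E\<close> is an orthonormal basis from the
  definition of its signature.
\<close>

lemma tangent_space_subset_span_vector_fields:
  assumes "finite E" "card E = DIM('e)" "tvec.span E = tangent_space \<A> p"
  shows "tangent_space \<A> p \<subseteq> tvec.span ((\<lambda>Z. Z p) ` vector_fields \<A>)"
proof -
  have "p \<in> (\<Union>(U, c)\<in>\<A>. U)"
    unfolding charts_cover by simp
  then obtain U c where chart: "(U, c) \<in> \<A>" and p: "p \<in> U"
    by auto
  obtain r where r: "0 < r" and ball: "cball (c p) r \<subseteq> c ` U"
    using chart_open[OF chart] p by (meson imageI open_contains_cball)
  define Z where "Z b = bump_coord_field U c (c p) r b" for b
  define y where "y b = (\<lambda>q. if q \<in> U then bump (c p) r (c q) * ((c q - c p) \<bullet> b) else 0)" for b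
  define \<beta> where "\<beta> = bump (c p) r (c p)"
  have \<beta>: "\<beta> > 0" unfolding \<beta>_def by (rule bump_center_pos[OF r])
  have Z: "Z b \<in> vector_fields \<A>" for b
    unfolding Z_def by (rule bump_coord_field_in_vector_fields[OF chart r ball])
  have Zy: "Z b p (y b') = (if b = b' then \<beta>\<^sup>2 else 0)" if "b \<in> Basis" "b' \<in> Basis" for b b'
    unfolding Z_def y_def \<beta>_def
    by (rule bump_coord_field_apply_coordinate[OF chart r ball p refl that])
  have inj: "inj_on (\<lambda>b. Z b p) Basis"
    using Zy \<beta> by (intro inj_onI) (metis power_eq_0_iff less_irrefl)
  have scalars_zero: "s v = 0"
    if eq0: "(\<Sum>v\<in>(\<lambda>b. Z b p) ` Basis. tscale (s v) v) = 0" and v: "v \<in> (\<lambda>b. Z b p) ` Basis"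
    for s v
  proof -
    obtain b where b: "b \<in> Basis" "v = Z b p" using v by blast
    have sum_apply: "(\<Sum>i\<in>I. G i) f = (\<Sum>i\<in>I. G i f)" for I :: "'e set" and G :: "'e \<Rightarrow> 'a tvec" and f
      by (induction I rule: infinite_finite_induct) auto
    have "0 = (\<Sum>b'\<in>Basis. tscale (s (Z b' p)) (Z b' p)) (y b)"
      using eq0 by (simp add: sum.reindex[OF inj])
    also have "\<dots> = (\<Sum>b'\<in>Basis. s (Z b' p) * Z b' p (y b))"
      by (simp add: sum_apply tscale_def)
    also have "\<dots> = (\<Sum>b'\<in>Basis. if b' = b then s (Z b p) * \<beta>\<^sup>2 else 0)"
      using b by (intro sum.cong refl) (auto simp: Zy)
    also have "\<dots> = s v * \<beta>\<^sup>2" using b by simp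
    finally show ?thesis using \<beta> by simp
  qed
  have indep: "tvec.independent ((\<lambda>b. Z b p) ` Basis)"
  proof
    assume dep: "tvec.dependent ((\<lambda>b. Z b p) ` Basis)"
    have "finite ((\<lambda>b. Z b p) ` Basis)" by simp
    from tvec.dependent_finite[OF this] dep obtain s v
      where v: "v \<in> (\<lambda>b. Z b p) ` Basis" "s v \<noteq> 0"
        and eq0: "(\<Sum>v\<in>(\<lambda>b. Z b p) ` Basis. tscale (s v) v) = 0"
      by (elim iffE) (drule (1) mp, elim exE conjE bexE)
    show False
      using scalars_zero[OF eq0 v(1)] v(2) by contradiction
  qed
  have in_span: "(\<lambda>b. Z b p) ` Basis \<subseteq> tvec.span E"
    unfolding assms(3) using Z by (auto simp: vector_fields_def)
  have "v \<in> tvec.span ((\<lambda>b. Z b p) ` Basis)" if "v \<in> tangent_space \<A> p" for v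
  proof (rule ccontr)
    assume notin: "v \<notin> tvec.span ((\<lambda>b. Z b p) ` Basis)"
    have "insert v ((\<lambda>b. Z b p) ` Basis) \<subseteq> tvec.span E"
      using in_span that unfolding assms(3) by simp
    from tvec.independent_span_bound[OF assms(1) tvec.independent_insertI[OF notin indep] this]
    have "card (insert v ((\<lambda>b. Z b p) ` Basis)) \<le> card E" by (rule conjunct2)
    moreover have "v \<notin> (\<lambda>b. Z b p) ` Basis"
      by (rule contrapos_nn[OF notin tvec.span_base])
    ultimately show False
      using assms(2) card_image[OF inj] by simp
  qed
  then have "tangent_space \<A> p \<subseteq> tvec.span ((\<lambda>b. Z b p) ` Basis)"
    by (rule subsetI)
  also have "\<dots> \<subseteq> tvec.span ((\<lambda>Z. Z p) ` vector_fields \<A>)"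
    using Z by (intro tvec.span_mono) auto
  finally show ?thesis .
qed

end

section \<open>Tangent vectors and vector fields as modules\<close>

context smooth_manifold
begin

lemma tangent_space_zero: "0 \<in> tangent_space \<A> p"
  by (simp add: tangent_space_def)

lemma tangent_space_add [simp]:
  "u \<in> tangent_space \<A> p \<Longrightarrow> v \<in> tangent_space \<A> p \<Longrightarrow> u + v \<in> tangent_space \<A> p"
  by (simp add: tangent_space_def algebra_simps)

lemma tangent_space_tscale [simp]: "u \<in> tangent_space \<A> p \<Longrightarrow> tscale r u \<in> tangent_space \<A> p"
  by (simp add: tangent_space_def tscale_def algebra_simps)

lemma diff_eq_add_tscale: "u - v = u + tscale (- 1) v" for u v :: "'a tvec"
  by (simp add: fun_eq_iff tscale_def)

lemma tangent_space_diff [simp]: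
  "u \<in> tangent_space \<A> p \<Longrightarrow> v \<in> tangent_space \<A> p \<Longrightarrow> u - v \<in> tangent_space \<A> p"
  by (subst diff_eq_add_tscale) (intro tangent_space_add tangent_space_tscale)

lemma tangent_vector_const:
  assumes "v \<in> tangent_space \<A> p"
  shows "v (\<lambda>q. r) = 0"
proof -
  have "v ((\<lambda>q. 1) * (\<lambda>q. 1)) = 1 * v (\<lambda>q. 1) + 1 * v (\<lambda>q. 1)"
    using assms smooth_fun_const[of 1] unfolding tangent_space_def by blast
  then have "v (\<lambda>q. 1) = 0" by (simp add: times_fun_def)
  moreover have "v (\<lambda>q. r * f q) = r * v f" if "f \<in> smooth_fun \<A>" for f
    using assms that by (simp add: tangent_space_def)
  from this[OF smooth_fun_const[of 1]] have "v (\<lambda>q. r) = r * v (\<lambda>q. 1)" by simp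
  ultimately show ?thesis by simp
qed

lemma vector_fieldsI:
  "(\<And>p. X p \<in> tangent_space \<A> p) \<Longrightarrow> (\<And>f. f \<in> smooth_fun \<A> \<Longrightarrow> (\<lambda>p. X p f) \<in> smooth_fun \<A>)
    \<Longrightarrow> X \<in> vector_fields \<A>"
  by (simp add: vector_fields_def)

lemma vector_field_apply_smooth:
  "X \<in> vector_fields \<A> \<Longrightarrow> f \<in> smooth_fun \<A> \<Longrightarrow> (\<lambda>p. X p f) \<in> smooth_fun \<A>"
  by (simp add: vector_fields_def)

lemma vector_field_at [simp]: "X \<in> vector_fields \<A> \<Longrightarrow> X p \<in> tangent_space \<A> p"
  by (simp add: vector_fields_def)

lemma vector_field_const: "X \<in> vector_fields \<A> \<Longrightarrow> X p (\<lambda>q. r) = 0"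
  by (rule tangent_vector_const[OF vector_field_at])

lemma vector_fields_add [simp]:
  assumes "X \<in> vector_fields \<A>" "Y \<in> vector_fields \<A>"
  shows "X + Y \<in> vector_fields \<A>"
proof (rule vector_fieldsI)
  show "(X + Y) p \<in> tangent_space \<A> p" for p using assms by simp
  show "(\<lambda>p. (X + Y) p f) \<in> smooth_fun \<A>" if "f \<in> smooth_fun \<A>" for f
    using smooth_fun_add[OF assms[THEN vector_field_apply_smooth, OF that]]
    by (simp add: plus_fun_def)
qed

lemma vector_fields_fscale [simp]:
  assumes "r \<in> smooth_fun \<A>" "X \<in> vector_fields \<A>"
  shows "r \<odot> X \<in> vector_fields \<A>"
proof (rule vector_fieldsI)
  show "(r \<odot> X) p \<in> tangent_space \<A> p" for p using assms by (simp add: fscale_def)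
  show "(\<lambda>p. (r \<odot> X) p f) \<in> smooth_fun \<A>" if "f \<in> smooth_fun \<A>" for f
    using smooth_fun_mult[OF assms(1) vector_field_apply_smooth[OF assms(2) that]]
    by (simp add: fscale_def tscale_def times_fun_def)
qed

lemma vector_field_diff_eq: "X - Y = X + (\<lambda>p. - 1) \<odot> Y" for X Y :: "'a vfield"
  by (simp add: fun_eq_iff fscale_def tscale_def)

lemma vector_fields_diff [simp]:
  assumes "X \<in> vector_fields \<A>" "Y \<in> vector_fields \<A>"
  shows "X - Y \<in> vector_fields \<A>"
  by (subst vector_field_diff_eq) (intro vector_fields_add vector_fields_fscale smooth_fun_const assms)

end

section \<open>Pointwise algebra of almost paracontact metric structures\<close>

context almost_paracontact_metric_manifold
begin

lemma phi_tangent [simp]: "u \<in> tangent_space \<A> p \<Longrightarrow> \<phi> p u \<in> tangent_space \<A> p"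
  and phi_add: "u \<in> tangent_space \<A> p \<Longrightarrow> v \<in> tangent_space \<A> p \<Longrightarrow> \<phi> p (u + v) = \<phi> p u + \<phi> p v"
  and phi_tscale: "u \<in> tangent_space \<A> p \<Longrightarrow> \<phi> p (tscale r u) = tscale r (\<phi> p u)"
  and phi_field [simp]: "X \<in> vector_fields \<A> \<Longrightarrow> \<phi>\<langle>X\<rangle> \<in> vector_fields \<A>"
  using phi by (auto simp: endomorphism_field_def)

lemma phi_diff:
  "u \<in> tangent_space \<A> p \<Longrightarrow> v \<in> tangent_space \<A> p \<Longrightarrow> \<phi> p (u - v) = \<phi> p u - \<phi> p v"
  using phi_add[of u p "tscale (- 1) v"] phi_tscale[of v p "- 1"] tangent_space_tscale[of v p "- 1"]
  by simp

lemma eta_add: "u \<in> tangent_space \<A> p \<Longrightarrow> v \<in> tangent_space \<A> p \<Longrightarrow> \<eta> p (u + v) = \<eta> p u + \<eta> p v"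
  and eta_tscale: "u \<in> tangent_space \<A> p \<Longrightarrow> \<eta> p (tscale r u) = r * \<eta> p u"
  and eta_field [simp]: "X \<in> vector_fields \<A> \<Longrightarrow> \<eta>\<langle>X\<rangle> \<in> smooth_fun \<A>"
  using eta by (auto simp: one_form_def)

lemma eta_diff:
  "u \<in> tangent_space \<A> p \<Longrightarrow> v \<in> tangent_space \<A> p \<Longrightarrow> \<eta> p (u - v) = \<eta> p u - \<eta> p v"
  using eta_add[of u p "tscale (- 1) v"] eta_tscale[of v p "- 1"] tangent_space_tscale[of v p "- 1"]
  by simp

lemma g_sym: "u \<in> tangent_space \<A> p \<Longrightarrow> v \<in> tangent_space \<A> p \<Longrightarrow> g p u v = g p v u"
  and g_add_left: "u \<in> tangent_space \<A> p \<Longrightarrow> v \<in> tangent_space \<A> p \<Longrightarrow> w \<in> tangent_space \<A> p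
    \<Longrightarrow> g p (u + v) w = g p u w + g p v w"
  and g_tscale_left: "u \<in> tangent_space \<A> p \<Longrightarrow> w \<in> tangent_space \<A> p \<Longrightarrow> g p (tscale r u) w = r * g p u w"
  using metric by (auto simp: pseudo_riemannian_metric_def symmetric_2_tensor_def)

lemma g_zero_left: "v \<in> tangent_space \<A> p \<Longrightarrow> g p 0 v = 0"
  using g_tscale_left[OF tangent_space_zero, of v p 0] by simp

lemma g_diff_left:
  "u \<in> tangent_space \<A> p \<Longrightarrow> v \<in> tangent_space \<A> p \<Longrightarrow> w \<in> tangent_space \<A> p
    \<Longrightarrow> g p (u - v) w = g p u w - g p v w"
  using g_add_left[of u p "tscale (- 1) v" w] g_tscale_left[of v p w "- 1"]
    tangent_space_tscale[of v p "- 1"]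
  by simp

lemma g_add_right:
  "u \<in> tangent_space \<A> p \<Longrightarrow> v \<in> tangent_space \<A> p \<Longrightarrow> w \<in> tangent_space \<A> p
    \<Longrightarrow> g p w (u + v) = g p w u + g p w v"
  using g_add_left[of u p v w] g_sym[of w p] by simp

lemma g_tscale_right:
  "u \<in> tangent_space \<A> p \<Longrightarrow> w \<in> tangent_space \<A> p \<Longrightarrow> g p w (tscale r u) = r * g p w u"
  using g_tscale_left[of u p w r] g_sym[of w p] by simp

lemma g_diff_right:
  "u \<in> tangent_space \<A> p \<Longrightarrow> v \<in> tangent_space \<A> p \<Longrightarrow> w \<in> tangent_space \<A> p
    \<Longrightarrow> g p w (u - v) = g p w u - g p w v"
  using g_diff_left[of u p v w] g_sym[of w p] by simp

lemma xi_field [simp]: "\<xi> \<in> vector_fields \<A>"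
  by (rule xi)

text \<open>
  Applying \<open>\<phi>\<^sup>2 = Id - \<eta> \<otimes> \<xi>\<close> to \<open>\<xi>\<close> and to \<open>y = \<phi> \<xi>\<close> gives \<open>\<phi> y = 0\<close> and \<open>y = \<eta>(y) \<xi>\<close>. Hence
  \<open>\<eta>(y) y = \<phi> y = 0\<close>, and either factor being zero makes \<open>y\<close> zero.
\<close>

lemma phi_xi: "\<phi> p (\<xi> p) = 0"
proof -
  define y where "y = \<phi> p (\<xi> p)"
  have y: "y \<in> tangent_space \<A> p" by (simp add: y_def)
  have phi_0: "\<phi> p 0 = 0"
    using phi_tscale[of "\<xi> p" p 0] by simp
  have phi_y: "\<phi> p y = 0"
    using phi_phi[of "\<xi> p" p] by (simp add: y_def eta_xi tscale_def fun_eq_iff)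
  then have y_eq: "y = tscale (\<eta> p y) (\<xi> p)"
    using phi_phi[OF y] phi_0 by simp
  then have "tscale (\<eta> p y) y = 0"
    using phi_y phi_tscale[of "\<xi> p" p "\<eta> p y"] by (simp add: y_def)
  then have "\<eta> p y = 0 \<or> y = 0" by simp
  then have "y = 0" using y_eq by auto
  then show ?thesis by (simp add: y_def)
qed

text \<open>
  Associativity of \<open>\<phi>\<^sup>3\<close>: computing it as \<open>\<phi>\<^sup>2 (\<phi> v)\<close> and as \<open>\<phi> (\<phi>\<^sup>2 v)\<close> gives
  \<open>\<phi> v - \<eta>(\<phi> v) \<xi> = \<phi> v\<close>.
\<close>

lemma eta_phi:
  assumes v: "v \<in> tangent_space \<A> p"
  shows "\<eta> p (\<phi> p v) = 0"
proof -
  have "\<phi> p v - tscale (\<eta> p (\<phi> p v)) (\<xi> p) = \<phi> p (\<phi> p (\<phi> p v))"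
    by (rule phi_phi[OF phi_tangent[OF v], symmetric])
  also have "\<dots> = \<phi> p v"
    using v by (simp add: phi_phi[OF v] phi_diff phi_tscale phi_xi)
  finally have "\<eta> p (\<phi> p v - tscale (\<eta> p (\<phi> p v)) (\<xi> p)) = \<eta> p (\<phi> p v)"
    by (rule arg_cong)
  then show ?thesis using v by (simp add: eta_diff eta_tscale eta_xi)
qed

lemma phi_phi_of_kernel:
  assumes "v \<in> tangent_space \<A> p" "\<eta> p v = 0"
  shows "\<phi> p (\<phi> p v) = v"
  using assms by (simp add: phi_phi tscale_def fun_eq_iff)

lemma phi_phi_field: "X \<in> vector_fields \<A> \<Longrightarrow> \<phi>\<langle>\<phi>\<langle>X\<rangle>\<rangle> = X - \<eta>\<langle>X\<rangle> \<odot> \<xi>"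
  by (rule ext) (simp add: ev_def fscale_def phi_phi)

lemma g_xi_left:
  assumes v: "v \<in> tangent_space \<A> p"
  shows "g p (\<xi> p) v = \<eta> p v"
proof -
  show ?thesis
    using metric_phi[of "\<xi> p" p v] v by (simp add: phi_xi eta_xi g_zero_left)
qed

lemma g_xi_right: "v \<in> tangent_space \<A> p \<Longrightarrow> g p v (\<xi> p) = \<eta> p v"
  using g_xi_left g_sym[of v p "\<xi> p"] by simp

lemma phi_skew:
  assumes u: "u \<in> tangent_space \<A> p" and v: "v \<in> tangent_space \<A> p"
  shows "g p (\<phi> p u) v = - g p u (\<phi> p v)"
proof -
  have "g p (\<phi> p u) (\<phi> p (\<phi> p v)) = - g p u (\<phi> p v)"
    using metric_phi[OF u phi_tangent[OF v]] v by (simp add: eta_phi)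
  moreover have "g p (\<phi> p u) (\<phi> p (\<phi> p v)) = g p (\<phi> p u) v"
    using u v by (simp add: phi_phi[OF v] g_diff_right g_tscale_right g_xi_right eta_phi)
  ultimately show ?thesis by simp
qed

text \<open>
  Nondegeneracy is a statement about tangent vectors, while the connection and the exterior
  derivatives only accept vector fields. Testing against vector fields suffices because their values
  at a point span the tangent space.
\<close>

lemma metric_separates_vector_fields:
  assumes W: "W \<in> vector_fields \<A>"
    and orth: "\<And>Z p. Z \<in> vector_fields \<A> \<Longrightarrow> g p (W p) (Z p) = 0"
  shows "W = 0"
proof
  fix p
  obtain e :: "nat \<Rightarrow> 'a tvec" where inj: "inj_on e {..<n + 1 + n}"
      and span: "tvec.span (e ` {..<n + 1 + n}) = tangent_space \<A> p"
    using metric unfolding pseudo_riemannian_metric_def has_signature_def by meson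
  have "card (e ` {..<n + 1 + n}) = DIM('e)"
    using card_image[OF inj] dimension by simp
  from tangent_space_subset_span_vector_fields[OF _ this span]
  have spanned: "tangent_space \<A> p \<subseteq> tvec.span ((\<lambda>Z. Z p) ` vector_fields \<A>)" by simp
  have orth_all: "g p (W p) v = 0" if v: "v \<in> tangent_space \<A> p" for v
  proof -
    let ?P = "\<lambda>v. v \<in> tangent_space \<A> p \<and> g p (W p) v = 0"
    have "?P v"
    proof (rule tvec.span_induct[where P = ?P])
      show "v \<in> tvec.span ((\<lambda>Z. Z p) ` vector_fields \<A>)"
        using spanned v by (rule subsetD)
      have "g p (W p) 0 = 0"
        using g_tscale_right[of "\<xi> p" p "W p" 0] W by simp
      then show "tvec.subspace (Collect ?P)"
        using W by (auto simp: tvec.subspace_def tangent_space_zero g_add_right g_tscale_right)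
      show "?P u" if "u \<in> (\<lambda>Z. Z p) ` vector_fields \<A>" for u
        using that orth by auto
    qed
    then show ?thesis by simp
  qed
  have "u = 0" if "u \<in> tangent_space \<A> p" "\<forall>v\<in>tangent_space \<A> p. g p u v = 0" for u
    using metric that unfolding pseudo_riemannian_metric_def nondegenerate_def by simp
  from this[of "W p"] show "W p = 0 p"
    using W orth_all by simp
qed

end

section \<open>The covariant derivative of the characteristic field\<close>

locale almost_alpha_paracosymplectic_levi_civita =
  almost_alpha_paracosymplectic_manifold \<A> n \<phi> \<xi> \<eta> g \<alpha>
  for \<A> :: "('a::{t2_space, second_countable_topology}, 'e::euclidean_space) atlas"
    and n \<phi> \<xi> \<eta> g \<alpha> +
  fixes nabla :: "'a connection"
  assumes levi_civita: "levi_civita \<A> g nabla"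
begin

lemma nabla_field [simp]:
    "X \<in> vector_fields \<A> \<Longrightarrow> Y \<in> vector_fields \<A> \<Longrightarrow> nabla X Y \<in> vector_fields \<A>"
  and nabla_add_left: "X \<in> vector_fields \<A> \<Longrightarrow> Y \<in> vector_fields \<A> \<Longrightarrow> Z \<in> vector_fields \<A>
    \<Longrightarrow> nabla (X + Y) Z = nabla X Z + nabla Y Z"
  and nabla_fscale_left: "f \<in> smooth_fun \<A> \<Longrightarrow> X \<in> vector_fields \<A> \<Longrightarrow> Y \<in> vector_fields \<A>
    \<Longrightarrow> nabla (f \<odot> X) Y = f \<odot> nabla X Y"
  and nabla_add_right: "X \<in> vector_fields \<A> \<Longrightarrow> Y \<in> vector_fields \<A> \<Longrightarrow> Z \<in> vector_fields \<A>
    \<Longrightarrow> nabla X (Y + Z) = nabla X Y + nabla X Z"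
  and nabla_fscale_right: "f \<in> smooth_fun \<A> \<Longrightarrow> X \<in> vector_fields \<A> \<Longrightarrow> Y \<in> vector_fields \<A>
    \<Longrightarrow> nabla X (f \<odot> Y) = deriv_along X f \<odot> Y + f \<odot> nabla X Y"
  using levi_civita by (simp_all add: levi_civita_def affine_connection_def)

lemma lie_bracket_eq:
  "X \<in> vector_fields \<A> \<Longrightarrow> Y \<in> vector_fields \<A> \<Longrightarrow> lie_bracket X Y = nabla X Y - nabla Y X"
  using levi_civita by (simp add: levi_civita_def)

lemma nabla_metric:
  assumes "X \<in> vector_fields \<A>" "Y \<in> vector_fields \<A>" "Z \<in> vector_fields \<A>"
  shows "X p (\<lambda>q. g q (Y q) (Z q)) = g p (nabla X Y p) (Z p) + g p (Y p) (nabla X Z p)"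
proof -
  have "deriv_along X (g\<langle>Y, Z\<rangle>) = g\<langle>nabla X Y, Z\<rangle> + g\<langle>Y, nabla X Z\<rangle>"
    using levi_civita assms by (simp add: levi_civita_def)
  from fun_cong[OF this, of p] show ?thesis by (simp add: deriv_along_def ev2_def)
qed

lemma nabla_diff_left:
  assumes "X \<in> vector_fields \<A>" "Y \<in> vector_fields \<A>" "Z \<in> vector_fields \<A>"
  shows "nabla (X - Y) Z = nabla X Z - nabla Y Z"
  using assms by (subst (1 2) vector_field_diff_eq) (simp add: nabla_add_left nabla_fscale_left smooth_fun_const)

lemma nabla_diff_right:
  assumes "X \<in> vector_fields \<A>" "Y \<in> vector_fields \<A>" "Z \<in> vector_fields \<A>"
  shows "nabla X (Y - Z) = nabla X Y - nabla X Z"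
proof -
  have "deriv_along X (\<lambda>p. - 1) \<odot> Z = 0"
    using vector_field_const[OF assms(1)]
    by (simp add: fun_eq_iff fscale_def tscale_def deriv_along_def)
  then show ?thesis
    using assms by (subst (1 2) vector_field_diff_eq) (simp add: nabla_add_right nabla_fscale_right smooth_fun_const)
qed

text \<open>
  Metric compatibility applied to \<open>\<eta> = g(\<xi>, \<cdot>)\<close>. With \<open>Y = \<xi>\<close> it makes \<open>\<nabla>\<xi>\<close> orthogonal to \<open>\<xi>\<close>, and the
  antisymmetric part in \<open>X\<close> and \<open>Y\<close> turns \<open>d\<eta> = 0\<close> into self-adjointness of \<open>\<nabla>\<xi>\<close>.
\<close>

lemma deriv_eta:
  assumes "X \<in> vector_fields \<A>" "Y \<in> vector_fields \<A>"
  shows "X p (\<eta>\<langle>Y\<rangle>) = \<eta> p (nabla X Y p) + g p (nabla X \<xi> p) (Y p)"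
  using nabla_metric[OF assms(1) xi_field assms(2), of p] assms by (simp add: g_xi_left ev_def)

lemma eta_nabla_xi:
  assumes "X \<in> vector_fields \<A>"
  shows "\<eta> p (nabla X \<xi> p) = 0"
proof -
  have "\<eta>\<langle>\<xi>\<rangle> = (\<lambda>q. 1)" by (simp add: ev_def eta_xi)
  then show ?thesis
    using deriv_eta[OF assms xi_field, of p] vector_field_const[OF assms] assms
    by (simp add: g_xi_right)
qed

lemma nabla_xi_self_adjoint:
  assumes X: "X \<in> vector_fields \<A>" and Y: "Y \<in> vector_fields \<A>"
  shows "g p (nabla X \<xi> p) (Y p) = g p (nabla Y \<xi> p) (X p)"
proof -
  have "X p (\<eta>\<langle>Y\<rangle>) - Y p (\<eta>\<langle>X\<rangle>) - \<eta> p (lie_bracket X Y p) = 0"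
    using fun_cong[OF eta_closed[OF X Y], of p] by (simp add: ext_deriv1_def deriv_along_def ev_def)
  then show ?thesis
    using X Y by (simp add: deriv_eta lie_bracket_eq eta_diff)
qed

lemma nabla_xi_xi: "nabla \<xi> \<xi> = 0"
proof (rule metric_separates_vector_fields)
  show "g p (nabla \<xi> \<xi> p) (Z p) = 0" if Z: "Z \<in> vector_fields \<A>" for Z p
    using nabla_xi_self_adjoint[OF xi_field Z, of p] Z by (simp add: g_xi_right eta_nabla_xi)
qed simp

lemma cov_deriv_endo_phi_apply:
  "cov_deriv_endo nabla X (ev \<phi>) Y p = nabla X \<phi>\<langle>Y\<rangle> p - \<phi> p (nabla X Y p)"
  by (simp add: cov_deriv_endo_def ev_def)

lemma cov_deriv_endo_phi_field [simp]:
  "X \<in> vector_fields \<A> \<Longrightarrow> Y \<in> vector_fields \<A> \<Longrightarrow> cov_deriv_endo nabla X (ev \<phi>) Y \<in> vector_fields \<A>"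
  by (simp add: cov_deriv_endo_def)

text \<open>
  This is \<open>d\<Phi> = 2\<alpha> \<eta> \<and> \<Phi>\<close> with \<open>\<xi>\<close> in the first slot. Terms with another \<open>\<xi>\<close> in \<open>\<Phi>\<close> vanish since
  \<open>\<phi> \<xi> = 0\<close>. Expanding the brackets by torsion-freeness and moving \<open>\<nabla>\<xi>\<close> and \<open>\<phi>\<close> across the metric,
  as \<open>\<nabla>\<xi>\<close> is self-adjoint and \<open>\<phi>\<close> is skew, leaves a single vector paired with \<open>Z\<close>.
\<close>

lemma cov_deriv_xi_phi:
  assumes Y: "Y \<in> vector_fields \<A>"
  shows "cov_deriv_endo nabla \<xi> (ev \<phi>) Y + \<phi>\<langle>nabla Y \<xi>\<rangle> + nabla (\<phi>\<langle>Y\<rangle>) \<xi>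
    = (\<lambda>p. 2 * \<alpha> p) \<odot> \<phi>\<langle>Y\<rangle>" (is "?L = ?R")
proof -
  have smooth: "(\<lambda>p. 2 * \<alpha> p) \<in> smooth_fun \<A>" using smooth_fun_scale[OF alpha] .
  have "?L - ?R = 0"
  proof (rule metric_separates_vector_fields)
    show "?L - ?R \<in> vector_fields \<A>" using Y smooth by simp
    fix Z p assume Z: "Z \<in> vector_fields \<A>"
    let ?B = "cov_deriv_endo nabla \<xi> (ev \<phi>) Y"
    have "\<xi> p (\<lambda>q. g q (\<phi> q (Y q)) (Z q)) - g p (\<phi> p (lie_bracket \<xi> Y p)) (Z p)
        - g p (\<phi> p (lie_bracket Z \<xi> p)) (Y p) = 2 * \<alpha> p * g p (\<phi> p (Y p)) (Z p)"
      using fun_cong[OF d_fundamental_form[OF xi_field Y Z], of p] Y Z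
      by (simp add: ext_deriv2_def wedge12_def fundamental_form_def deriv_along_def ev_def ev2_def
          vector_field_const eta_xi g_xi_right eta_phi phi_xi g_zero_left lie_bracket_eq)
    moreover have "\<xi> p (\<lambda>q. g q (\<phi> q (Y q)) (Z q))
        = g p (nabla \<xi> (\<phi>\<langle>Y\<rangle>) p) (Z p) + g p (\<phi> p (Y p)) (nabla \<xi> Z p)"
      using nabla_metric[OF xi_field phi_field[OF Y] Z, of p] by (simp add: ev_def)
    moreover have "g p (\<phi> p (lie_bracket \<xi> Y p)) (Z p)
        = g p (\<phi> p (nabla \<xi> Y p)) (Z p) - g p (\<phi> p (nabla Y \<xi> p)) (Z p)"
      using Y Z by (simp add: lie_bracket_eq phi_diff g_diff_left)
    moreover have "g p (\<phi> p (lie_bracket Z \<xi> p)) (Y p)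
        = g p (\<phi> p (Y p)) (nabla \<xi> Z p) - g p (nabla (\<phi>\<langle>Y\<rangle>) \<xi> p) (Z p)"
    proof -
      have "g p (nabla (\<phi>\<langle>Y\<rangle>) \<xi> p) (Z p) = g p (nabla Z \<xi> p) (\<phi> p (Y p))"
        using nabla_xi_self_adjoint[OF phi_field[OF Y] Z, of p] by (simp add: ev_def)
      then show ?thesis
        using Y Z g_sym[of "\<phi> p (Y p)" p "nabla \<xi> Z p"]
        by (simp add: lie_bracket_eq phi_diff g_diff_left phi_skew)
    qed
    moreover have "g p ((?L - ?R) p) (Z p) = g p (nabla \<xi> (\<phi>\<langle>Y\<rangle>) p) (Z p) - g p (\<phi> p (nabla \<xi> Y p)) (Z p)
        + g p (\<phi> p (nabla Y \<xi> p)) (Z p) + g p (nabla (\<phi>\<langle>Y\<rangle>) \<xi> p) (Z p) - 2 * \<alpha> p * g p (\<phi> p (Y p)) (Z p)"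
    proof -
      have eq: "(?L - ?R) p = nabla \<xi> (\<phi>\<langle>Y\<rangle>) p - \<phi> p (nabla \<xi> Y p) + \<phi> p (nabla Y \<xi> p)
          + nabla (\<phi>\<langle>Y\<rangle>) \<xi> p - tscale (2 * \<alpha> p) (\<phi> p (Y p))"
        by (simp add: cov_deriv_endo_def ev_def fscale_def)
      show ?thesis
        unfolding eq using Y Z by (simp add: g_add_left g_diff_left g_tscale_left)
    qed
    ultimately show "g p ((?L - ?R) p) (Z p) = 0" by linarith
  qed
  then show ?thesis by simp
qed

text \<open>
  The derivative along \<open>\<xi>\<close> of \<open>\<phi>\<^sup>2 = Id - \<eta> \<otimes> \<xi>\<close>; the right-hand side is parallel in this direction
  because \<open>\<nabla>\<^sub>\<xi> \<xi> = 0\<close>.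
\<close>

lemma cov_deriv_xi_phi_anticommute:
  assumes Y: "Y \<in> vector_fields \<A>"
  shows "cov_deriv_endo nabla \<xi> (ev \<phi>) (\<phi>\<langle>Y\<rangle>) p = - \<phi> p (cov_deriv_endo nabla \<xi> (ev \<phi>) Y p)"
proof -
  have "nabla \<xi> (\<phi>\<langle>\<phi>\<langle>Y\<rangle>\<rangle>) p = nabla \<xi> Y p - tscale (\<xi> p (\<eta>\<langle>Y\<rangle>)) (\<xi> p)"
    unfolding phi_phi_field[OF Y] using Y by (simp add: nabla_diff_right nabla_fscale_right nabla_xi_xi,
        simp add: fscale_def deriv_along_def)
  also have "\<xi> p (\<eta>\<langle>Y\<rangle>) = \<eta> p (nabla \<xi> Y p)"
  proof -
    have "g p (nabla \<xi> \<xi> p) (Y p) = 0"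
      using nabla_xi_self_adjoint[OF xi_field Y, of p] Y by (simp add: g_xi_right eta_nabla_xi)
    then show ?thesis using Y by (simp add: deriv_eta)
  qed
  also have "nabla \<xi> Y p - tscale (\<eta> p (nabla \<xi> Y p)) (\<xi> p) = \<phi> p (\<phi> p (nabla \<xi> Y p))"
    using Y by (simp add: phi_phi)
  finally show ?thesis
    using Y by (simp add: cov_deriv_endo_phi_apply phi_diff)
qed

text \<open>
  Write \<open>A = \<nabla>\<xi>\<close> and \<open>B = \<nabla>\<^sub>\<xi> \<phi>\<close>. Composing \<open>B + \<phi>A + A\<phi> = 2\<alpha>\<phi>\<close> with \<open>\<phi>\<close> on the left and on the right,
  and using \<open>\<phi>\<^sup>2 A = A = A \<phi>\<^sup>2\<close>, shows that \<open>B\<close> commutes with \<open>\<phi>\<close>. As it also anticommutes, \<open>\<phi>B = 0\<close>.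
\<close>

lemma phi_cov_deriv_xi_phi:
  assumes Y: "Y \<in> vector_fields \<A>"
  shows "\<phi> p (cov_deriv_endo nabla \<xi> (ev \<phi>) Y p) = 0"
proof -
  let ?B = "cov_deriv_endo nabla \<xi> (ev \<phi>)"
  have "nabla (\<phi>\<langle>\<phi>\<langle>Y\<rangle>\<rangle>) \<xi> p = nabla Y \<xi> p"
    unfolding phi_phi_field[OF Y] using Y by (simp add: nabla_diff_left nabla_fscale_left nabla_xi_xi, simp add: fscale_def)
  then have 1: "?B (\<phi>\<langle>Y\<rangle>) p + \<phi> p (nabla (\<phi>\<langle>Y\<rangle>) \<xi> p) + nabla Y \<xi> p
      = tscale (2 * \<alpha> p) (\<phi> p (\<phi> p (Y p)))"
    using fun_cong[OF cov_deriv_xi_phi[OF phi_field[OF Y]], of p] by (simp add: ev_def fscale_def)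
  have "\<phi> p (?B Y p + \<phi> p (nabla Y \<xi> p) + nabla (\<phi>\<langle>Y\<rangle>) \<xi> p) = \<phi> p (tscale (2 * \<alpha> p) (\<phi> p (Y p)))"
    using fun_cong[OF cov_deriv_xi_phi[OF Y], of p] by (simp add: ev_def fscale_def)
  then have 2: "\<phi> p (?B Y p) + nabla Y \<xi> p + \<phi> p (nabla (\<phi>\<langle>Y\<rangle>) \<xi> p) = tscale (2 * \<alpha> p) (\<phi> p (\<phi> p (Y p)))"
    using Y by (simp add: phi_add phi_tscale phi_phi_of_kernel eta_nabla_xi)
  show ?thesis
  proof
    fix f
    show "\<phi> p (?B Y p) f = 0 f"
      using fun_cong[OF 1, of f] fun_cong[OF 2, of f]
        fun_cong[OF cov_deriv_xi_phi_anticommute[OF Y, of p], of f]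
      by simp
  qed
qed

text \<open>
  With \<open>A = \<nabla>\<xi>\<close> and \<open>B = \<nabla>\<^sub>\<xi> \<phi>\<close>, torsion-freeness gives \<open>2h = B - A\<phi> + \<phi>A\<close>, hence \<open>2\<phi>h = A - \<phi>A\<phi>\<close>
  because \<open>\<phi>B = 0\<close>. The relation from \<open>d\<Phi>\<close>, composed with \<open>\<phi>\<close>, reads \<open>A + \<phi>A\<phi> = 2\<alpha>\<phi>\<^sup>2\<close>. Adding both
  determines \<open>A\<close>.
\<close>

lemma nabla_xi_eq:
  assumes Y: "Y \<in> vector_fields \<A>"
  shows "nabla Y \<xi> = \<alpha> \<odot> (Y - \<eta>\<langle>Y\<rangle> \<odot> \<xi>) + \<phi>\<langle>h_operator \<phi> \<xi> Y\<rangle>"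
proof
  fix p
  let ?B = "cov_deriv_endo nabla \<xi> (ev \<phi>) Y p"
  have "\<phi> p (?B + \<phi> p (nabla Y \<xi> p) + nabla (\<phi>\<langle>Y\<rangle>) \<xi> p) = \<phi> p (tscale (2 * \<alpha> p) (\<phi> p (Y p)))"
    using fun_cong[OF cov_deriv_xi_phi[OF Y], of p] by (simp add: ev_def fscale_def)
  then have 1: "nabla Y \<xi> p + \<phi> p (nabla (\<phi>\<langle>Y\<rangle>) \<xi> p) = tscale (2 * \<alpha> p) (Y p - tscale (\<eta> p (Y p)) (\<xi> p))"
    using Y by (simp add: phi_add phi_tscale phi_phi_of_kernel eta_nabla_xi phi_cov_deriv_xi_phi
        phi_phi[of "Y p"])
  have h: "h_operator \<phi> \<xi> Y p = tscale (1 / 2) (?B - nabla (\<phi>\<langle>Y\<rangle>) \<xi> p + \<phi> p (nabla Y \<xi> p))"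
  proof -
    have "\<phi>\<langle>lie_bracket \<xi> Y\<rangle> p = \<phi> p (nabla \<xi> Y p) - \<phi> p (nabla Y \<xi> p)"
      using Y by (simp add: ev_def lie_bracket_eq phi_diff)
    then show ?thesis
      using Y by (simp add: h_operator_def lie_deriv_endo_def lie_bracket_eq cov_deriv_endo_phi_apply
          fscale_def)
  qed
  have phi_h: "\<phi> p (h_operator \<phi> \<xi> Y p) = tscale (1 / 2) (nabla Y \<xi> p - \<phi> p (nabla (\<phi>\<langle>Y\<rangle>) \<xi> p))"
    unfolding h using Y
    by (simp add: phi_tscale phi_add phi_diff phi_cov_deriv_xi_phi phi_phi_of_kernel eta_nabla_xi)
  show "nabla Y \<xi> p = (\<alpha> \<odot> (Y - \<eta>\<langle>Y\<rangle> \<odot> \<xi>) + \<phi>\<langle>h_operator \<phi> \<xi> Y\<rangle>) p"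
  proof
    fix f
    show "nabla Y \<xi> p f = (\<alpha> \<odot> (Y - \<eta>\<langle>Y\<rangle> \<odot> \<xi>) + \<phi>\<langle>h_operator \<phi> \<xi> Y\<rangle>) p f"
      using fun_cong[OF 1, of f] fun_cong[OF phi_h, of f]
      by (simp add: fscale_def ev_def[of \<phi> "h_operator \<phi> \<xi> Y"] ev_def[of \<eta>] tscale_def algebra_simps)
  qed
qed

lemma phi_h_field: "Y \<in> vector_fields \<A> \<Longrightarrow> \<phi>\<langle>h_operator \<phi> \<xi> Y\<rangle> \<in> vector_fields \<A>"
  by (simp add: h_operator_def lie_deriv_endo_def lie_bracket_eq smooth_fun_const)

section \<open>The curvature in the characteristic direction\<close>

text \<open>
  Differentiate the formula for \<open>\<nabla>\<^sub>Y \<xi>\<close> along \<open>X\<close>, antisymmetrize, and subtract the formula for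
  \<open>\<nabla>\<xi>\<close> at \<open>[X, Y] = \<nabla>\<^sub>X Y - \<nabla>\<^sub>Y X\<close>. The derivatives of \<open>\<eta>\<close> cancel because \<open>\<eta>\<close> is closed.
\<close>

theorem curvature_xi:
  assumes X: "X \<in> vector_fields \<A>" and Y: "Y \<in> vector_fields \<A>"
  shows "curvature nabla X Y \<xi> =
      (differential \<alpha>)\<langle>X\<rangle> \<odot> (Y - \<eta>\<langle>Y\<rangle> \<odot> \<xi>) - (differential \<alpha>)\<langle>Y\<rangle> \<odot> (X - \<eta>\<langle>X\<rangle> \<odot> \<xi>)
      + (\<alpha> * \<eta>\<langle>X\<rangle>) \<odot> (\<alpha> \<odot> Y + \<phi>\<langle>h_operator \<phi> \<xi> Y\<rangle>)
      - (\<alpha> * \<eta>\<langle>Y\<rangle>) \<odot> (\<alpha> \<odot> X + \<phi>\<langle>h_operator \<phi> \<xi> X\<rangle>)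
      + cov_deriv_endo nabla X (ev \<phi> \<circ> h_operator \<phi> \<xi>) Y
      - cov_deriv_endo nabla Y (ev \<phi> \<circ> h_operator \<phi> \<xi>) X"
proof -
  let ?P = "\<lambda>Z. \<phi>\<langle>h_operator \<phi> \<xi> Z\<rangle>"
  have second: "nabla U (nabla V \<xi>) = deriv_along U \<alpha> \<odot> (V - \<eta>\<langle>V\<rangle> \<odot> \<xi>)
      + \<alpha> \<odot> (nabla U V - (deriv_along U (\<eta>\<langle>V\<rangle>) \<odot> \<xi> + \<eta>\<langle>V\<rangle> \<odot> nabla U \<xi>)) + nabla U (?P V)"
    if "U \<in> vector_fields \<A>" "V \<in> vector_fields \<A>" for U V
    unfolding nabla_xi_eq[OF that(2)] using that alpha
    by (simp add: nabla_add_right nabla_diff_right nabla_fscale_right phi_h_field)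
  have bracket: "nabla (lie_bracket X Y) \<xi> = nabla (nabla X Y) \<xi> - nabla (nabla Y X) \<xi>"
    using X Y by (simp add: lie_bracket_eq nabla_diff_left)
  have eta_bracket: "X p (\<eta>\<langle>Y\<rangle>) - Y p (\<eta>\<langle>X\<rangle>) = \<eta> p (nabla X Y p) - \<eta> p (nabla Y X p)" for p
    using X Y nabla_xi_self_adjoint[OF X Y, of p] by (simp add: deriv_eta)
  show ?thesis
  proof (rule ext, rule ext)
    fix p f
    let ?x = "\<xi> p f"
    \<comment> \<open>The identity at \<open>p\<close> and \<open>f\<close> is linear in the formulas for \<open>\<nabla>\<xi>\<close> at the two covariant derivatives
      and in those at \<open>X\<close> and \<open>Y\<close>, the latter multiplied by \<open>\<alpha> \<eta>(Y)\<close> and \<open>\<alpha> \<eta>(X)\<close>.\<close>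
    have "\<alpha> p * ((X p (\<eta>\<langle>Y\<rangle>) - Y p (\<eta>\<langle>X\<rangle>)) * ?x) = \<alpha> p * ((\<eta> p (nabla X Y p) - \<eta> p (nabla Y X p)) * ?x)"
      unfolding eta_bracket ..
    moreover note
      fun_cong[OF fun_cong[OF nabla_xi_eq[OF nabla_field[OF X Y]]], of p f]
      fun_cong[OF fun_cong[OF nabla_xi_eq[OF nabla_field[OF Y X]]], of p f]
      arg_cong[where f = "\<lambda>t. \<alpha> p * (\<eta> p (Y p) * t)", OF fun_cong[OF fun_cong[OF nabla_xi_eq[OF X]], of p f]]
      arg_cong[where f = "\<lambda>t. \<alpha> p * (\<eta> p (X p) * t)", OF fun_cong[OF fun_cong[OF nabla_xi_eq[OF Y]], of p f]]
    ultimately show "curvature nabla X Y \<xi> p f = (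
      (differential \<alpha>)\<langle>X\<rangle> \<odot> (Y - \<eta>\<langle>Y\<rangle> \<odot> \<xi>) - (differential \<alpha>)\<langle>Y\<rangle> \<odot> (X - \<eta>\<langle>X\<rangle> \<odot> \<xi>)
      + (\<alpha> * \<eta>\<langle>X\<rangle>) \<odot> (\<alpha> \<odot> Y + ?P Y) - (\<alpha> * \<eta>\<langle>Y\<rangle>) \<odot> (\<alpha> \<odot> X + ?P X)
      + cov_deriv_endo nabla X (ev \<phi> \<circ> h_operator \<phi> \<xi>) Y
      - cov_deriv_endo nabla Y (ev \<phi> \<circ> h_operator \<phi> \<xi>) X) p f"
      unfolding curvature_def second[OF X Y] second[OF Y X] bracket
      by (simp add: cov_deriv_endo_def fscale_def tscale_def deriv_along_def differential_def
          ev_def[of "\<lambda>p v. v \<alpha>"] ev_def[of \<eta>] algebra_simps)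
  qed
qed

end

theorem theorem2:
  fixes \<A> :: "('a::{t2_space, second_countable_topology}, 'e::euclidean_space) atlas"
    and n :: nat
    and \<phi> :: "'a endo" and \<xi> :: "'a vfield" and \<eta> :: "'a form1" and g :: "'a form2"
    and \<alpha> :: "'a \<Rightarrow> real"
    and nabla :: "'a connection"
    and h :: "'a vfield \<Rightarrow> 'a vfield"
    and X Y :: "'a vfield"
  assumes "almost_alpha_paracosymplectic_manifold \<A> n \<phi> \<xi> \<eta> g \<alpha>"
    and "levi_civita \<A> g nabla"
    and "h = h_operator \<phi> \<xi>"
    and "X \<in> vector_fields \<A>" and "Y \<in> vector_fields \<A>"
  shows "curvature nabla X Y \<xi> =
      (differential \<alpha>)\<langle>X\<rangle> \<odot> (Y - \<eta>\<langle>Y\<rangle> \<odot> \<xi>) - (differential \<alpha>)\<langle>Y\<rangle> \<odot> (X - \<eta>\<langle>X\<rangle> \<odot> \<xi>)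
      + (\<alpha> * \<eta>\<langle>X\<rangle>) \<odot> (\<alpha> \<odot> Y + \<phi>\<langle>h Y\<rangle>) - (\<alpha> * \<eta>\<langle>Y\<rangle>) \<odot> (\<alpha> \<odot> X + \<phi>\<langle>h X\<rangle>)
      + cov_deriv_endo nabla X (ev \<phi> \<circ> h) Y - cov_deriv_endo nabla Y (ev \<phi> \<circ> h) X"
proof -
  interpret almost_alpha_paracosymplectic_levi_civita \<A> n \<phi> \<xi> \<eta> g \<alpha> nabla
    using assms(1,2)
    by (simp add: almost_alpha_paracosymplectic_levi_civita_def
        almost_alpha_paracosymplectic_levi_civita_axioms_def)
  show ?thesis
    unfolding assms(3) by (rule curvature_xi[OF assms(4,5)])
qed

end
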